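(* Let $p,s,m,n$ be integers such that $p\geq s>0$, $m\geq 0$ and $n=(2m+1)s$. If there exists a nonzero radial function $\phi$ such that $T_{e^{ip\theta}\phi}$ commutes with $T_{e^{-is\theta}r^n}$ on $L^2_h$, then $p=s=1$ and $\phi(r)=\sum_{j=0}^{m}c_j r^{2j-1}$ for some constants $c_0,\dots,c_m\in\mathbb{C}$.
   Context: Let $\mathbb{D}$ be the open unit disk in $\mathbb{C}$, with normalized Lebesgue area measure $dA=\frac{1}{\pi}r\,dr\,d\theta$ in polar coordinates $(r,\theta)$. The harmonic Bergman space $L^2_h$ is the closed subspace of $L^2(\mathbb{D},dA)$ consisting of all (complex-valued) harmonic functions on $\mathbb{D}$ belonging to $L^2(\mathbb{D},dA)$. Let $R_z$ denote the reproducing kernel of $L^2_h$ at $z\in\mathbb{D}$. For $f\in L^1(\mathbb{D},dA)$, the Toeplitz operator $T_f$ with symbol $f$ is densely defined on $L^2_h$ by $(T_fu)(z)=\int_{\mathbb{D}}f(w)u(w)R_z(w)\,dA(w)$ for $u$ a harmonic polynomial (a finite linear combination of $z^n,\bar z^n$, $n\ge 0$). If $f$ is bounded, then $T_fu=Q(fu)$, where $Q$ is the orthogonal projection of $L^2(\mathbb{D},dA)$ onto $L^2_h$. Standing assumption: all symbols considered belong to $L^1(\mathbb{D},dA)$ and are such that the Toeplitz operator so defined extends to a bounded operator on $L^2_h$; $T_f$ denotes this extension. A radial function $\phi$ on $\mathbb{D}$ is one depending only on $r=|z|$; it is identified with a function on $[0,1)$ (an element of $L^1([0,1],r\,dr)$),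 and functions are identified when equal almost everywhere. For an integer $p$, $e^{ip\theta}\phi$ denotes the symbol $re^{i\theta}\mapsto e^{ip\theta}\phi(r)$; in particular $e^{-is\theta}r^n$ is the symbol $re^{i\theta}\mapsto e^{-is\theta}r^n$. Two bounded operators $S,T$ commute if $ST=TS$. *)

theory Defs
  imports "HOL-Analysis.Analysis"
begin

abbreviation disk :: "complex set" where
  "disk \<equiv> ball 0 1"

definition area_measure :: "complex measure" where
  "area_measure = density (lebesgue_on disk) (\<lambda>_. ennreal (1 / pi))"

text \<open>
  A complex-valued function on an open set is harmonic if it is twice continuously
  (real-)differentiable with vanishing Laplacian.  The functions \<open>ux, uy\<close> are the first-order
  partial derivatives of \<open>u\<close>, and \<open>uxx, uxy, uyx, uyy\<close> those of \<open>ux\<close> and \<open>uy\<close>.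
\<close>

definition has_partials_on ::
    "(complex \<Rightarrow> complex) \<Rightarrow> (complex \<Rightarrow> complex) \<Rightarrow> (complex \<Rightarrow> complex) \<Rightarrow> complex set \<Rightarrow> bool" where
  "has_partials_on u ux uy S \<longleftrightarrow>
     (\<forall>z\<in>S. (u has_derivative (\<lambda>h. Re h *\<^sub>R ux z + Im h *\<^sub>R uy z)) (at z))"

definition harmonic_on :: "(complex \<Rightarrow> complex) \<Rightarrow> complex set \<Rightarrow> bool" where
  "harmonic_on u S \<longleftrightarrow> open S \<and>
     (\<exists>ux uy uxx uxy uyx uyy.
        has_partials_on u ux uy S \<and> has_partials_on ux uxx uxy S \<and> has_partials_on uy uyx uyy S \<and>
        continuous_on S uxx \<and> continuous_on S uxy \<and> continuous_on S uyx \<and> continuous_on S uyy \<and>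
        (\<forall>z\<in>S. uxx z + uyy z = 0))"

text \<open>
  Elements of the harmonic Bergman space are functions on the disk.  They are represented by
  total functions that vanish off the disk, so that equality in the space is equality in HOL
  (harmonic functions that agree almost everywhere on the disk agree everywhere on it).
\<close>

definition harmonic_bergman :: "(complex \<Rightarrow> complex) set" where
  "harmonic_bergman =
     {u. harmonic_on u disk \<and> (\<forall>z. z \<notin> disk \<longrightarrow> u z = 0) \<and>
         integrable area_measure (\<lambda>z. (cmod (u z))\<^sup>2)}"

definition l2_inner :: "(complex \<Rightarrow> complex) \<Rightarrow> (complex \<Rightarrow> complex) \<Rightarrow> complex" where
  "l2_inner u v = (LINT w|area_measure. u w * cnj (v w))"

definition l2_norm :: "(complex \<Rightarrow> complex) \<Rightarrow> real" where
  "l2_norm u = sqrt (LINT w|area_measure. (cmod (u w))\<^sup>2)"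

definition bergman_kernel :: "complex \<Rightarrow> complex \<Rightarrow> complex" where
  "bergman_kernel z =
     (THE R. R \<in> harmonic_bergman \<and> (\<forall>u\<in>harmonic_bergman. u z = l2_inner u R))"

definition harmonic_polynomial :: "(complex \<Rightarrow> complex) \<Rightarrow> bool" where
  "harmonic_polynomial u \<longleftrightarrow>
     (\<exists>N a b. u = (\<lambda>z. if z \<in> disk then \<Sum>k\<le>N::nat. a k * z ^ k + b k * cnj z ^ k else 0))"

definition bounded_operator :: "((complex \<Rightarrow> complex) \<Rightarrow> complex \<Rightarrow> complex) \<Rightarrow> bool" where
  "bounded_operator T \<longleftrightarrow>
     T \<in> harmonic_bergman \<rightarrow> harmonic_bergman \<and>
     (\<forall>u\<in>harmonic_bergman. \<forall>v\<in>harmonic_bergman. T (\<lambda>z. u z + v z) = (\<lambda>z. T u z + T v z)) \<and>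
     (\<forall>c. \<forall>u\<in>harmonic_bergman. T (\<lambda>z. c * u z) = (\<lambda>z. c * T u z)) \<and>
     (\<exists>C. \<forall>u\<in>harmonic_bergman. l2_norm (T u) \<le> C * l2_norm u)"

text \<open>
  \<open>toeplitz_operator f T\<close>: the symbol \<open>f\<close> is integrable and \<open>T\<close> is the bounded extension to the
  harmonic Bergman space of the Toeplitz operator with symbol \<open>f\<close>.  As the harmonic polynomials
  are dense, this determines \<open>T\<close> on the harmonic Bergman space; its values at functions
  outside that space are irrelevant.
\<close>

definition toeplitz_operator ::
    "(complex \<Rightarrow> complex) \<Rightarrow> ((complex \<Rightarrow> complex) \<Rightarrow> complex \<Rightarrow> complex) \<Rightarrow> bool" where
  "toeplitz_operator f T \<longleftrightarrow>
     integrable area_measure f \<and> bounded_operator T \<and>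
     (\<forall>u. harmonic_polynomial u \<longrightarrow>
        (\<forall>z\<in>disk. T u z = (LINT w|area_measure. f w * u w * bergman_kernel z w)))"

definition operators_commute ::
    "((complex \<Rightarrow> complex) \<Rightarrow> complex \<Rightarrow> complex) \<Rightarrow>
     ((complex \<Rightarrow> complex) \<Rightarrow> complex \<Rightarrow> complex) \<Rightarrow> bool" where
  "operators_commute S T \<longleftrightarrow> (\<forall>u\<in>harmonic_bergman. S (T u) = T (S u))"

definition radial_measure :: "real measure" where
  "radial_measure = density (lebesgue_on {0..<1}) (\<lambda>r. ennreal r)"

text \<open>
  The symbol \<open>r e\<^sup>i\<^sup>\<theta> \<mapsto> e\<^sup>i\<^sup>p\<^sup>\<theta> \<phi>(r)\<close>; as \<open>p\<close> is an integer, the choice of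
  argument is immaterial (and the origin is a null set).
\<close>

definition quasihomogeneous :: "int \<Rightarrow> (real \<Rightarrow> complex) \<Rightarrow> complex \<Rightarrow> complex" where
  "quasihomogeneous p \<phi> z = cis (of_int p * Arg z) * \<phi> (cmod z)"

end

(*
  Only the action on the powers z^k is used.  The kernel of the harmonic Bergman space is
  R_z(w) = 1/(1 - z cnj w)^2 + 1/(1 - cnj z w)^2 - 1; expanding it in powers of w and using
  rotation invariance, T z^k = 2 (q+1) M(k+q) z^q with q = k + p, where M(j) is the integral of
  phi r^j against r dr, and S z^(q+s) = (q+1)/((m+1)s+q+1) z^q.  Comparing T S and S T on
  z^(s(l+1)) gives a two-term recurrence for M(2sl+p), whose solution is a constant C times
    F(x) = prod_{j=1..m} (x + js + p) / prod_{j=0..m} (x + js)   at x = sl + 1.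
  Writing F(x) = sum_j A_j/(x + js), the right-hand side is the moment sequence of
  2C sum_j A_j r^(2js), and by the Weierstrass approximation theorem the moments along r^(2sl)
  determine a function, so phi r^p = 2C sum_j A_j r^(2js).  As A_0 is nonzero, integrability
  of phi against r dr forces p = 1, hence s = 1.
*)

theory Submission
  imports Defs "HOL-Complex_Analysis.Complex_Analysis"
begin

section \<open>Area measure and polar coordinates\<close>

text \<open>Since n = (2m+1)s, n + s is an even multiple of s, so the coefficients of S involve a
  shift by m+1 whole steps of length s. The recurrence advances by the same step, and the Gamma
  quotients that would solve it for general n collapse to finite products. Hence F is rational with
  simple poles, and its denominator has degree one more than its numerator. Only powers z^k with k
  >= s are tested: S lowers them to nonnegative powers and T raises degrees, so conjugate powers
  never enter. Near 0 the term A_0 gives phi the size r^(-p), which is integrable against r dr only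
  for p < 2.

  Much of the work goes into the kernel. It is a definite description, so a candidate must be shown
  to reproduce every member of the space and to be the only one that does. The parts of u = f + cnj
  g are not known to be integrable separately, so the reproducing formula is proved on smaller disks
  and passed to the limit. Radial symbols are Lebesgue measurable only, so polar coordinates need
  Borel representatives.\<close>

lemma space_area_measure: "space area_measure = disk"
  by (simp add: area_measure_def)

lemma AE_disk: "AE w in area_measure. w \<in> disk"
  using AE_space[of area_measure] by (simp add: space_area_measure)

lemma borel_measurable_area_measure:
  fixes f :: "complex \<Rightarrow> 'a::euclidean_space"
  assumes "f \<in> borel_measurable borel"
  shows "f \<in> borel_measurable area_measure"
proof -
  have "f \<in> borel_measurable lebesgue"
    using assms by (simp add: measurable_completion)
  then show ?thesis
    unfolding area_measure_def by (simp add: measurable_restrict_space1)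
qed

lemma finite_measure_area_measure: "finite_measure area_measure"
proof
  have "emeasure area_measure (space area_measure)
      = (\<integral>\<^sup>+ x. ennreal (1 / pi) * indicator disk x \<partial>lebesgue_on disk)"
    unfolding area_measure_def
    by (subst emeasure_density) (auto intro!: nn_integral_cong)
  also have "\<dots> = ennreal (1 / pi) * emeasure lebesgue disk"
    by (subst nn_integral_cmult_indicator) (auto simp: emeasure_restrict_space)
  also have "\<dots> \<noteq> \<infinity>"
    by (simp add: ennreal_mult_eq_top_iff emeasure_ball)
  finally show "emeasure area_measure (space area_measure) \<noteq> \<infinity>" .
qed

lemma borel_measurable_area_measure_iff:
  "f \<in> borel_measurable area_measure \<longleftrightarrow> f \<in> borel_measurable (lebesgue_on disk)"
  unfolding area_measure_def measurable_density_eq1 ..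

lemma integral_area_measure_conv:
  fixes f :: "complex \<Rightarrow> complex"
  assumes "f \<in> borel_measurable area_measure"
  shows "integral\<^sup>L area_measure f = (1 / pi) *\<^sub>R (LINT x|lebesgue. indicator disk x *\<^sub>R f x)"
proof -
  have "f \<in> borel_measurable (lebesgue_on disk)"
    using assms unfolding borel_measurable_area_measure_iff .
  then have "integral\<^sup>L area_measure f = (LINT x|lebesgue_on disk. (1 / pi) *\<^sub>R f x)"
    unfolding area_measure_def by (rule integral_density) auto
  also have "\<dots> = (1 / pi) *\<^sub>R (LINT x|lebesgue_on disk. f x)"
    by (rule integral_scaleR_right)
  also have "(LINT x|lebesgue_on disk. f x) = (LINT x|lebesgue. indicator disk x *\<^sub>R f x)"
    by (rule integral_restrict_space) simp
  finally show ?thesis .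
qed

text \<open>Invariance of Lebesgue measure under orthogonal maps is available for \<open>real^'n\<close> only; this lemma transfers it to the complex plane.\<close>

lemma complex_vec_lborel:
  "distr (lborel :: (real^2) measure) borel (\<lambda>v. Complex (v $ 1) (v $ 2)) = lborel"
proof (rule lborel_eqI[symmetric])
  let ?f = "\<lambda>v::real^2. Complex (v $ 1) (v $ 2)"
  have cont: "continuous_on UNIV ?f"
    unfolding Complex_eq by (intro continuous_intros)
  then have meas: "?f \<in> borel_measurable borel"
    by (rule borel_measurable_continuous_onI)
  fix l u :: complex
  assume le': "\<And>b. b \<in> Basis \<Longrightarrow> l \<bullet> b \<le> u \<bullet> b"
  have le: "Re l \<le> Re u" "Im l \<le> Im u"
    using le'[of 1] le'[of \<i>] by (auto simp: Basis_complex_def)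
  have vimage: "?f -` box l u = box (vector [Re l, Im l]) (vector [Re u, Im u])"
    by (auto simp: mem_box_cart set_eq_iff forall_2 vector_2 in_box_complex_iff)
  have B: "(Basis::(real^2) set) = {axis 1 1, axis 2 1}"
    by (auto simp: Basis_vec_def UNIV_2)
  have ne: "axis 1 (1::real) \<noteq> (axis 2 1 :: real^2)"
    by (simp add: axis_eq_axis)
  have "emeasure (distr lborel borel ?f) (box l u) = emeasure lborel (?f -` box l u)"
    using meas by (subst emeasure_distr) auto
  also have "\<dots> = ennreal ((Re u - Re l) * (Im u - Im l))"
    unfolding vimage using le ne
    by (subst emeasure_lborel_box) (auto simp: B inner_axis vector_2)
  finally show "emeasure (distr lborel borel ?f) (box l u) = (\<Prod>b\<in>Basis. (u - l) \<bullet> b)"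
    by (simp add: Basis_complex_def)
qed simp

text \<open>Multiplication by c becomes a linear isometry \<open>R c\<close> of the real plane. Such
  maps preserve the volume of boxes, boxes determine the measure, and \<open>?f\<close> carries the
  result back to the complex plane.\<close>

lemma lborel_rotation:
  assumes c: "cmod c = 1"
  shows "distr (lborel :: complex measure) borel (\<lambda>w. c * w) = lborel"
proof -
  let ?f = "\<lambda>v::real^2. Complex (v $ 1) (v $ 2)"
  let ?g = "\<lambda>w::complex. vector [Re w, Im w] :: real^2"
  define R where "R = (\<lambda>c v. ?g (c * ?f v))"
  have gf [simp]: "?g (?f v) = v" for v
    by (simp add: vec_eq_iff forall_2 vector_2)
  have fg [simp]: "?f (?g w) = w" for w
    by (simp add: vector_2)
  have mf: "?f \<in> borel_measurable borel"
    unfolding Complex_eq by (intro borel_measurable_continuous_onI continuous_intros)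
  have lin: "linear (R c)" for c
    by (rule linearI) (auto simp: R_def vec_eq_iff forall_2 vector_2 algebra_simps)
  have mR: "R c \<in> borel_measurable borel" for c
    by (intro borel_measurable_continuous_onI linear_continuous_on linear_conv_bounded_linear[THEN iffD1] lin)
  have orth: "orthogonal_transformation (R c)" if "cmod c = 1" for c
  proof (subst orthogonal_transformation, intro conjI allI lin)
    fix v :: "real^2"
    have n: "norm v = cmod (?f v)" for v :: "real^2"
      by (simp add: norm_vec_def L2_set_def UNIV_2 cmod_def)
    have "norm (R c v) = cmod (?f (R c v))"
      by (rule n)
    also have "\<dots> = cmod (c * ?f v)"
      unfolding R_def fg ..
    also have "\<dots> = norm v"
      unfolding norm_mult n[of v] that by (rule mult_1)
    finally show "norm (R c v) = norm v" .
  qed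
  have cc: "c * cnj c = 1" "cnj c * c = 1"
    using c complex_norm_square[of c] by (simp_all add: mult.commute)
  have inv: "R c (R (cnj c) v) = v" "R (cnj c) (R c v) = v" for v
    unfolding R_def fg mult.assoc[symmetric] cc mult_1_left by (rule gf)+
  have Rl: "distr (lborel :: (real^2) measure) borel (R c) = lborel"
  proof (rule lborel_eqI[symmetric])
    fix l u :: "real^2"
    assume le: "\<And>b. b \<in> Basis \<Longrightarrow> l \<bullet> b \<le> u \<bullet> b"
    \<comment> \<open>Volume invariance is available for images, so the preimage is rewritten as the
      image under the inverse \<open>R (cnj c)\<close>.\<close>
    have im: "R c -` box l u = R (cnj c) ` box l u"
      using inv by (metis (no_types, lifting) vimageE vimageI image_eqI imageE subsetI subset_antisym)
    have oc: "orthogonal_transformation (R (cnj c))"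
      using c by (intro orth) simp
    have lm: "R (cnj c) ` box l u \<in> lmeasurable"
      by (intro measurable_orthogonal_image oc lmeasurable_box)
    have bm: "R (cnj c) ` box l u \<in> sets borel"
      using measurable_sets_borel[OF mR, of "box l u" c] by (simp flip: im)
    have "emeasure (distr lborel borel (R c)) (box l u) = emeasure lborel (R (cnj c) ` box l u)"
      using mR by (subst emeasure_distr) (auto simp: im)
    also have "\<dots> = emeasure lebesgue (R (cnj c) ` box l u)"
      using bm by simp
    also have "\<dots> = ennreal (measure lebesgue (R (cnj c) ` box l u))"
      using lm by (simp add: emeasure_eq_measure2)
    also have "\<dots> = emeasure lborel (box l u)"
      by (subst measure_orthogonal_image) (auto simp: oc lmeasurable_box measure_completion emeasure_eq_measure2 emeasure_lborel_box_finite)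
    also have "\<dots> = (\<Prod>b\<in>Basis. (u - l) \<bullet> b)"
      using le by (rule emeasure_lborel_box)
    finally show "emeasure (distr lborel borel (R c)) (box l u) = (\<Prod>b\<in>Basis. (u - l) \<bullet> b)" .
  qed simp
  have mf': "?f \<in> lborel \<rightarrow>\<^sub>M borel"
    using mf unfolding measurable_lborel2 .
  have mR': "R c \<in> lborel \<rightarrow>\<^sub>M borel"
    using mR unfolding measurable_lborel2 .
  have mc: "(\<lambda>w. c * w) \<in> borel_measurable borel"
    by simp
  have comp: "(\<lambda>w. c * w) \<circ> ?f = ?f \<circ> R c"
    unfolding R_def o_def fg ..
  have "distr lborel borel (\<lambda>w. c * w) = distr (distr lborel borel ?f) borel (\<lambda>w. c * w)"
    unfolding complex_vec_lborel ..
  also have "\<dots> = distr lborel borel (?f \<circ> R c)"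
    by (subst distr_distr[OF mc mf']) (simp only: comp)
  also have "\<dots> = distr (distr lborel borel (R c)) borel ?f"
    by (rule distr_distr[OF mf mR', symmetric])
  also have "\<dots> = lborel"
    unfolding Rl by (rule complex_vec_lborel)
  finally show ?thesis .
qed

lemma integral_area_measure_rotation:
  fixes f :: "complex \<Rightarrow> complex"
  assumes c: "cmod c = 1" and f: "f \<in> borel_measurable area_measure"
  shows "(LINT w|area_measure. f (c * w)) = integral\<^sup>L area_measure f"
proof -
  let ?R = "\<lambda>w::complex. c * w"
  have [measurable]: "?R \<in> borel_measurable borel"
    by simp
  have *: "distr lebesgue lborel ?R = lborel"
    using lborel_rotation[OF c] by (simp add: distr_completion cong: distr_cong)
  \<comment> \<open>For the completed sigma-algebra it is not enough that the rotation is Borel: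
    null sets must pull back to null sets, which \<open>*\<close> provides.\<close>
  have mR [measurable]: "?R \<in> lebesgue \<rightarrow>\<^sub>M lebesgue"
    by (rule completion.measurable_completion2) (simp_all add: * measurable_completion)
  have dR: "distr lebesgue lebesgue ?R = lebesgue"
    using completion.completion_distr_eq[of ?R lborel lborel] by (simp add: * measurable_completion)
  have f' [measurable]: "f \<in> borel_measurable (lebesgue_on disk)"
    using f unfolding borel_measurable_area_measure_iff .
  have g: "(\<lambda>x. indicator disk x *\<^sub>R f x) \<in> borel_measurable lebesgue"
    using f' by (simp add: borel_measurable_restrict_space_iff scaleR_conv_of_real)
  have ind: "indicator disk (c * x) = (indicator disk x :: real)" for x
    using c by (auto simp: indicator_def norm_mult)
  have "(\<lambda>x. f (c * x)) \<in> borel_measurable (lebesgue_on disk)"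
    using measurable_compose[OF mR g] by (simp add: ind borel_measurable_restrict_space_iff)
  then have "(\<lambda>x. f (c * x)) \<in> borel_measurable area_measure"
    unfolding borel_measurable_area_measure_iff .
  then have "(LINT w|area_measure. f (c * w))
      = (1 / pi) *\<^sub>R (LINT x|lebesgue. indicator disk (c * x) *\<^sub>R f (c * x))"
    by (simp add: integral_area_measure_conv ind)
  also have "(LINT x|lebesgue. indicator disk (c * x) *\<^sub>R f (c * x))
      = (LINT x|distr lebesgue lebesgue ?R. indicator disk x *\<^sub>R f x)"
    using g by (subst integral_distr) simp_all
  finally show ?thesis
    using f by (simp add: dR integral_area_measure_conv)
qed

lemma AE_area_measureI:
  assumes "AE w in lebesgue. P w"
  shows "AE w in area_measure. P w"
proof -
  have "AE w in lebesgue_on disk. P w"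
    using assms by (subst AE_restrict_space_iff) auto
  then show ?thesis
    unfolding area_measure_def by (subst AE_density) auto
qed

lemma AE_area_measure_nonzero: "AE w in area_measure. w \<noteq> 0"
proof (rule AE_area_measureI)
  have "AE w in lborel. w \<noteq> (0::complex)"
    by (rule AE_lborel_singleton)
  then show "AE w in lebesgue. w \<noteq> (0::complex)"
    by (rule AE_completion)
qed

text \<open>Rotation by the angle pi/j preserves the integral and turns f into -f, so the integral
  is its own negative. The origin is exempt because symbols built with \<open>Arg\<close> need not
  transform correctly there.\<close>

lemma integral_area_measure_eq_0:
  fixes f :: "complex \<Rightarrow> complex"
  assumes f: "f \<in> borel_measurable area_measure" and "j \<noteq> 0"
    and rot: "\<And>t w. w \<noteq> 0 \<Longrightarrow> f (cis t * w) = cis (of_int j * t) * f w"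
  shows "integral\<^sup>L area_measure f = 0"
proof -
  define t where "t = pi / of_int j"
  have "cis (of_int j * t) = -1"
    using \<open>j \<noteq> 0\<close> by (simp add: t_def)
  then have f_t: "f (cis t * w) = - f w" if "w \<noteq> 0" for w
    using rot[OF that, of t] by simp
  have "(LINT w|area_measure. f (cis t * w)) = (LINT w|area_measure. - f w)"
  proof (rule integral_cong_AE)
    have AE: "AE w in area_measure. f (cis t * w) = - f w"
      using AE_area_measure_nonzero by eventually_elim (rule f_t)
    then show "AE w in area_measure. f (cis t * w) = - f w" .
    \<comment> \<open>Off the origin the rotated function is -f, so its measurability reduces to
      that of f and of the point 0.\<close>
    have "(\<lambda>w. if w = 0 then f 0 else - f w) \<in> borel_measurable area_measure"
    proof (rule measurable_If)
      have "{0} \<in> sets lebesgue" by simp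
      then have "{0} \<in> sets (lebesgue_on disk)"
        by (simp add: sets_restrict_space_iff)
      moreover have "{w \<in> space area_measure. w = 0} = {0}"
        by (auto simp: space_area_measure)
      ultimately show "{w \<in> space area_measure. w = 0} \<in> sets area_measure"
        by (simp add: area_measure_def)
    qed (use f in auto)
    moreover have "(\<lambda>w. f (cis t * w)) = (\<lambda>w. if w = 0 then f 0 else - f w)"
      using f_t by auto
    ultimately show "(\<lambda>w. f (cis t * w)) \<in> borel_measurable area_measure"
      by simp
  qed (use f in auto)
  then show ?thesis
    using integral_area_measure_rotation[OF _ f, of "cis t"] by simp
qed

section \<open>Polar coordinates for radial integrands\<close>

text \<open>Half-lines determine a finite measure on the line. The preimage of {x<..} is an annulus
  of normalized area 1 - x^2, which is the integral of 2r from x to 1; clamping x to the unit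
  interval covers the remaining cases.\<close>

lemma distr_cmod_area_measure:
  "distr area_measure borel cmod = density lborel (\<lambda>r. ennreal (2 * r * indicator {0..<1} r))"
proof (rule measure_eqI_lessThan)
  have cm: "cmod \<in> borel_measurable area_measure"
    by (rule borel_measurable_area_measure) simp
  fix x :: real
  let ?A = "cmod -` {x<..} \<inter> space area_measure"
  have A: "?A = disk - cball 0 x"
    by (auto simp: space_area_measure)
  have "emeasure (distr area_measure borel cmod) {x<..} = emeasure area_measure (disk - cball 0 x)"
    using cm by (subst emeasure_distr) (auto simp: A)
  also have "\<dots> = ennreal (1 / pi) * emeasure lebesgue (disk - cball 0 x)"
    unfolding area_measure_def
    by (subst emeasure_density_const) (auto simp: sets_restrict_space_iff emeasure_restrict_space)
  also have "emeasure lebesgue (disk - cball 0 x) = ennreal (pi * (1 - (max 0 (min 1 x))\<^sup>2))"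
  proof -
    consider "x < 0" | "0 \<le> x" "x < 1" | "1 \<le> x" by linarith
    then show ?thesis
    proof cases
      case 1
      then have "disk - cball 0 x = disk" by auto
      then show ?thesis using 1 by (simp add: emeasure_ball unit_ball_vol_2)
    next
      case 2
      have "emeasure lebesgue (disk - cball 0 x) = emeasure lebesgue disk - emeasure lebesgue (cball (0::complex) x)"
        using 2 by (intro emeasure_Diff) (auto simp: emeasure_cball)
      also have "\<dots> = ennreal (pi * (1 - x\<^sup>2))"
        using 2 by (simp add: emeasure_ball emeasure_cball unit_ball_vol_2 ennreal_minus power_le_one algebra_simps)
      finally show ?thesis using 2 by simp
    next
      case 3
      then have "disk - cball 0 x = {}" by auto
      then show ?thesis using 3 by (simp only:) simp
    qed
  qed
  also have "ennreal (1 / pi) * \<dots> = ennreal (1 - (max 0 (min 1 x))\<^sup>2)"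
    by (subst ennreal_mult'[symmetric]) (auto simp: power_le_one)
  finally have L: "emeasure (distr area_measure borel cmod) {x<..} = ennreal (1 - (max 0 (min 1 x))\<^sup>2)" .
  then show "emeasure (distr area_measure borel cmod) {x<..} < \<infinity>" by simp
  let ?y = "max 0 (min 1 x)"
  have "emeasure (density lborel (\<lambda>r. ennreal (2 * r * indicator {0..<1} r))) {x<..}
      = (\<integral>\<^sup>+r. ennreal (2 * r * indicator {0..<1} r) * indicator {x<..} r \<partial>lborel)"
    by (subst emeasure_density) auto
  \<comment> \<open>Changing the integrand at the null points \<open>?y\<close> and 1 gives a closed
    interval, as the fundamental theorem of calculus requires.\<close>
  also have "\<dots> = (\<integral>\<^sup>+r. ennreal (2 * r) * indicator {?y..1} r \<partial>lborel)"
    using AE_lborel_singleton[of ?y] AE_lborel_singleton[of 1]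
    by (intro nn_integral_cong_AE, eventually_elim) (auto simp: indicator_def)
  also have "\<dots> = ennreal (1\<^sup>2 - ?y\<^sup>2)"
    by (rule nn_integral_FTC_Icc) (auto intro!: derivative_eq_intros)
  finally show "emeasure (distr area_measure borel cmod) {x<..}
      = emeasure (density lborel (\<lambda>r. ennreal (2 * r * indicator {0..<1} r))) {x<..}"
    by (simp add: L)
qed auto

lemma borel_measurable_radial_measure_iff:
  "g \<in> borel_measurable radial_measure \<longleftrightarrow> g \<in> borel_measurable (lebesgue_on {0..<1})"
  unfolding radial_measure_def measurable_density_eq1 ..

lemma
  fixes g :: "real \<Rightarrow> 'a::{banach, second_countable_topology}"
  assumes g: "g \<in> borel_measurable radial_measure"
  shows integrable_radial_measure_iff: "integrable radial_measure g \<longleftrightarrow>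
      integrable lebesgue (\<lambda>r. indicator {0..<1} r *\<^sub>R (r *\<^sub>R g r))"
    and integral_radial_measure: "integral\<^sup>L radial_measure g =
      (LINT r|lebesgue. indicator {0..<1} r *\<^sub>R (r *\<^sub>R g r))"
proof -
  have ms: "{0..<1::real} \<in> sets lebesgue"
    by (intro sets_completionI_sets) simp
  have g': "g \<in> borel_measurable (lebesgue_on {0..<1})"
    using g unfolding borel_measurable_radial_measure_iff .
  have "AE r in lebesgue_on {0..<1}. 0 \<le> (r::real)"
    using ms by (subst AE_restrict_space_iff) auto
  moreover have "(\<lambda>r. r) \<in> borel_measurable (lebesgue_on {0..<1::real})"
    by (intro measurable_restrict_space1) (rule measurable_completion, simp)
  ultimately have "integrable radial_measure g \<longleftrightarrow> integrable (lebesgue_on {0..<1}) (\<lambda>r. r *\<^sub>R g r)"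
    and "integral\<^sup>L radial_measure g = (LINT r|lebesgue_on {0..<1}. r *\<^sub>R g r)"
    unfolding radial_measure_def using g'
    by (auto simp: integrable_density integral_density)
  then show "integrable radial_measure g \<longleftrightarrow>
      integrable lebesgue (\<lambda>r. indicator {0..<1} r *\<^sub>R (r *\<^sub>R g r))"
    and "integral\<^sup>L radial_measure g = (LINT r|lebesgue. indicator {0..<1} r *\<^sub>R (r *\<^sub>R g r))"
    using ms by (simp_all add: integrable_restrict_space integral_restrict_space)
qed

lemma completion_ex_borel_measurable_complex:
  fixes g :: "'a \<Rightarrow> complex"
  assumes "g \<in> borel_measurable (completion M)"
  obtains h where "h \<in> borel_measurable M" "AE x in M. g x = h x"
proof -
  have "(\<lambda>x. Re (g x)) \<in> borel_measurable (completion M)" "(\<lambda>x. Im (g x)) \<in> borel_measurable (completion M)"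
    using assms by auto
  from this[THEN completion_ex_borel_measurable_real]
  obtain a b where [measurable]: "a \<in> borel_measurable M" "b \<in> borel_measurable M"
    and ab: "AE x in M. Re (g x) = a x" "AE x in M. Im (g x) = b x"
    by blast
  show ?thesis
  proof (rule that)
    show "(\<lambda>x. Complex (a x) (b x)) \<in> borel_measurable M"
      unfolding Complex_eq by measurable
    show "AE x in M. g x = Complex (a x) (b x)"
      using ab by eventually_elim (simp add: complex_eq_iff)
  qed
qed

text \<open>The factor 2 is 1/pi times the full angle. As g is only Lebesgue measurable, it is
  replaced by a Borel function h that agrees with it almost everywhere; by the law of
  \<open>cmod\<close>, the exceptional radii sweep out a null set of the disk.\<close>

lemma integral_area_measure_radial:
  fixes g :: "real \<Rightarrow> complex"
  assumes F: "F \<in> borel_measurable area_measure" and g: "g \<in> borel_measurable radial_measure"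
    and Fg: "AE w in area_measure. F w = g (cmod w)"
  shows "integral\<^sup>L area_measure F = 2 * integral\<^sup>L radial_measure g"
proof -
  have ms: "{0..<1::real} \<in> sets lebesgue"
    by (intro sets_completionI_sets) simp
  have g1: "g \<in> borel_measurable (lebesgue_on {0..<1})"
    using g unfolding borel_measurable_radial_measure_iff .
  then have g2: "(\<lambda>r. indicator {0..<1} r *\<^sub>R g r) \<in> borel_measurable lebesgue"
    using ms by (subst borel_measurable_restrict_space_iff[symmetric]) auto
  obtain h where h [measurable]: "h \<in> borel_measurable lborel"
    and gh: "AE r in lborel. indicator {0..<1} r *\<^sub>R g r = h r"
    by (rule completion_ex_borel_measurable_complex[OF g2])
  have hb: "h \<in> borel_measurable borel"
    using h unfolding measurable_lborel2 .
  have cm: "cmod \<in> area_measure \<rightarrow>\<^sub>M borel"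
    by (rule borel_measurable_area_measure) simp
  have "AE r in density lborel (\<lambda>r. ennreal (2 * r * indicator {0..<1} r)). indicator {0..<1} r *\<^sub>R g r = h r"
    using gh by (subst AE_density) auto
  then have "AE r in distr area_measure borel cmod. indicator {0..<1} r *\<^sub>R g r = h r"
    unfolding distr_cmod_area_measure .
  then have "AE w in area_measure. indicator {0..<1} (cmod w) *\<^sub>R g (cmod w) = h (cmod w)"
    by (rule AE_distrD[OF cm])
  then have Fh: "AE w in area_measure. F w = h (cmod w)"
    using Fg AE_disk by eventually_elim simp
  have "integral\<^sup>L area_measure F = (LINT w|area_measure. h (cmod w))"
    using F Fh measurable_compose[OF cm hb] by (intro integral_cong_AE) auto
  also have "\<dots> = integral\<^sup>L (distr area_measure borel cmod) h"
    using hb by (subst integral_distr[OF cm]) auto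
  also have "\<dots> = (LINT r|lborel. (2 * r * indicator {0..<1} r) *\<^sub>R h r)"
    unfolding distr_cmod_area_measure
    by (subst integral_density) (auto simp: indicator_def)
  also have "\<dots> = (LINT r|lebesgue. (2 * r * indicator {0..<1} r) *\<^sub>R h r)"
    by (subst integral_completion) auto
  also have "\<dots> = (LINT r|lebesgue. indicator {0..<1} r *\<^sub>R (2 *\<^sub>R (r *\<^sub>R g r)))"
  proof (rule integral_cong_AE)
    show "(\<lambda>r. (2 * r * indicator {0..<1} r) *\<^sub>R h r) \<in> borel_measurable lebesgue"
      by (rule measurable_completion) measurable
    have "(\<lambda>r. (2 * r) *\<^sub>R (indicator {0..<1} r *\<^sub>R g r)) \<in> borel_measurable lebesgue"
      by (rule borel_measurable_scaleR[OF _ g2]) (rule measurable_completion, measurable)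
    then show "(\<lambda>r. indicator {0..<1} r *\<^sub>R (2 *\<^sub>R (r *\<^sub>R g r))) \<in> borel_measurable lebesgue"
      by (simp add: mult.commute mult.left_commute)
    show "AE r in lebesgue. (2 * r * indicator {0..<1} r) *\<^sub>R h r = indicator {0..<1} r *\<^sub>R (2 *\<^sub>R (r *\<^sub>R g r))"
      using AE_completion[OF gh] by eventually_elim (auto simp: indicator_def)
  qed
  also have "\<dots> = 2 *\<^sub>R (LINT r|lebesgue. indicator {0..<1} r *\<^sub>R (r *\<^sub>R g r))"
    by (subst integral_scaleR_right[symmetric]) (simp only: scaleR_left_commute)
  also have "(LINT r|lebesgue. indicator {0..<1} r *\<^sub>R (r *\<^sub>R g r)) = integral\<^sup>L radial_measure g"
    by (rule integral_radial_measure[OF g, symmetric])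
  finally show ?thesis
    by (simp add: scaleR_conv_of_real)
qed

section \<open>Harmonic functions on the disk\<close>

text \<open>The x-derivative of a holomorphic f is f' and its y-derivative is i f'. The partials are
  again holomorphic plus conjugate holomorphic, so the lemma applies to them in turn and yields the
  second order.\<close>

lemma has_partials_on_holomorphic_add_cnj:
  assumes "\<And>z. z \<in> S \<Longrightarrow> (f has_field_derivative f' z) (at z)"
    and "\<And>z. z \<in> S \<Longrightarrow> (g has_field_derivative g' z) (at z)"
  shows "has_partials_on (\<lambda>z. f z + cnj (g z)) (\<lambda>z. f' z + cnj (g' z))
     (\<lambda>z. \<i> * f' z + cnj (\<i> * g' z)) S"
  unfolding has_partials_on_def
proof
  fix z assume z: "z \<in> S"
  have "((\<lambda>z. f z + cnj (g z)) has_derivative (\<lambda>h. f' z * h + cnj (g' z * h))) (at z)"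
    using assms[OF z] by (intro has_derivative_add has_derivative_cnj) (simp_all add: has_field_derivative_def)
  moreover have "(\<lambda>h. f' z * h + cnj (g' z * h)) =
      (\<lambda>h. Re h *\<^sub>R (f' z + cnj (g' z)) + Im h *\<^sub>R (\<i> * f' z + cnj (\<i> * g' z)))"
    by (auto simp: fun_eq_iff complex_eq_iff algebra_simps)
  ultimately show "((\<lambda>z. f z + cnj (g z)) has_derivative
      (\<lambda>h. Re h *\<^sub>R (f' z + cnj (g' z)) + Im h *\<^sub>R (\<i> * f' z + cnj (\<i> * g' z)))) (at z)"
    by simp
qed

lemma has_partials_on_cong:
  assumes "open S" "\<And>z. z \<in> S \<Longrightarrow> u z = v z" "has_partials_on u ux uy S"
  shows "has_partials_on v ux uy S"
  unfolding has_partials_on_def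
proof
  fix z assume z: "z \<in> S"
  then have "(u has_derivative (\<lambda>h. Re h *\<^sub>R ux z + Im h *\<^sub>R uy z)) (at z)"
    using assms(3) by (auto simp: has_partials_on_def)
  then show "(v has_derivative (\<lambda>h. Re h *\<^sub>R ux z + Im h *\<^sub>R uy z)) (at z)"
    using assms(1) z assms(2) by (rule has_derivative_transform_within_open)
qed

lemma harmonic_on_holomorphic_add_cnj:
  assumes S: "open S" and f: "f holomorphic_on S" and g: "g holomorphic_on S"
    and u: "\<And>z. z \<in> S \<Longrightarrow> u z = f z + cnj (g z)"
  shows "harmonic_on u S"
proof -
  define f' where "f' = deriv f"
  define g' where "g' = deriv g"
  define f'' where "f'' = deriv f'"
  define g'' where "g'' = deriv g'"
  have hol: "f' holomorphic_on S" "g' holomorphic_on S" "f'' holomorphic_on S" "g'' holomorphic_on S"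
    unfolding f'_def g'_def f''_def g''_def using f g S by (auto intro!: holomorphic_deriv)
  have df: "(f has_field_derivative f' z) (at z)" "(f' has_field_derivative f'' z) (at z)"
    and dg: "(g has_field_derivative g' z) (at z)" "(g' has_field_derivative g'' z) (at z)" if "z \<in> S" for z
    using holomorphic_derivI[OF f S that] holomorphic_derivI[OF g S that]
      holomorphic_derivI[OF hol(1) S that] holomorphic_derivI[OF hol(2) S that]
    unfolding f'_def g'_def f''_def g''_def by simp_all
  note c = hol(3,4)[THEN holomorphic_on_imp_continuous_on]
  have P1: "has_partials_on u (\<lambda>z. f' z + cnj (g' z)) (\<lambda>z. \<i> * f' z + cnj (\<i> * g' z)) S"
    by (rule has_partials_on_cong[OF S _ has_partials_on_holomorphic_add_cnj[OF df(1) dg(1)]]) (simp_all add: u)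
  have P2: "has_partials_on (\<lambda>z. f' z + cnj (g' z)) (\<lambda>z. f'' z + cnj (g'' z)) (\<lambda>z. \<i> * f'' z + cnj (\<i> * g'' z)) S"
    by (intro has_partials_on_holomorphic_add_cnj df dg)
  have P3: "has_partials_on (\<lambda>z. \<i> * f' z + cnj (\<i> * g' z)) (\<lambda>z. \<i> * f'' z + cnj (\<i> * g'' z))
      (\<lambda>z. \<i> * (\<i> * f'' z) + cnj (\<i> * (\<i> * g'' z))) S"
    by (intro has_partials_on_holomorphic_add_cnj DERIV_cmult df dg)
  have c1: "continuous_on S (\<lambda>z. f'' z + cnj (g'' z))"
    and c2: "continuous_on S (\<lambda>z. \<i> * f'' z + cnj (\<i> * g'' z))"
    and c3: "continuous_on S (\<lambda>z. \<i> * (\<i> * f'' z) + cnj (\<i> * (\<i> * g'' z)))"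
    by (intro continuous_intros c)+
  have "f'' z + cnj (g'' z) + (\<i> * (\<i> * f'' z) + cnj (\<i> * (\<i> * g'' z))) = 0" for z
    by (simp add: mult.assoc[symmetric])
  with S P1 P2 P3 c1 c2 c3 show ?thesis
    unfolding harmonic_on_def by blast
qed

section \<open>Symmetry of the mixed partials and splitting into holomorphic parts\<close>

lemma DERIV_partials:
  fixes v :: "complex \<Rightarrow> real"
  assumes "(v has_derivative (\<lambda>h. Re h * p + Im h * q)) (at (Complex (a + x) (b + y)))"
  shows "((\<lambda>t. v (Complex (a + t) (b + y))) has_real_derivative p) (at x)"
    and "((\<lambda>t. v (Complex (a + x) (b + t))) has_real_derivative q) (at y)"
proof -
  have "((\<lambda>t. Complex (a + t) (b + y)) has_derivative (\<lambda>t. Complex t 0)) (at x)"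
    unfolding Complex_eq by (auto intro!: derivative_eq_intros)
  from has_derivative_compose[OF this assms]
  show "((\<lambda>t. v (Complex (a + t) (b + y))) has_real_derivative p) (at x)"
    by (simp add: has_field_derivative_def mult.commute[of p] mult_commute_abs)
  have "((\<lambda>t. Complex (a + x) (b + t)) has_derivative (\<lambda>t. Complex 0 t)) (at y)"
    unfolding Complex_eq by (auto intro!: derivative_eq_intros)
  from has_derivative_compose[OF this assms]
  show "((\<lambda>t. v (Complex (a + x) (b + t))) has_real_derivative q) (at y)"
    by (simp add: has_field_derivative_def mult.commute[of q] mult_commute_abs)
qed

text \<open>Apply the mean value theorem twice, in either order, to the second difference of \<open>v\<close> over a small square at \<open>a\<close>.\<close>

lemma mixed_partials_eq:
  fixes v :: "complex \<Rightarrow> real"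
  assumes S: "open S" and a: "a \<in> S"
    and v: "\<And>z. z \<in> S \<Longrightarrow> (v has_derivative (\<lambda>h. Re h * vx z + Im h * vy z)) (at z)"
    and vx: "\<And>z. z \<in> S \<Longrightarrow> (vx has_derivative (\<lambda>h. Re h * vxx z + Im h * vxy z)) (at z)"
    and vy: "\<And>z. z \<in> S \<Longrightarrow> (vy has_derivative (\<lambda>h. Re h * vyx z + Im h * vyy z)) (at z)"
    and cxy: "continuous_on S vxy" and cyx: "continuous_on S vyx"
  shows "vxy a = vyx a"
proof (rule ccontr)
  assume ne: "vxy a \<noteq> vyx a"
  \<comment> \<open>Half the gap: a common value within e of both \<open>vxy a\<close> and
    \<open>vyx a\<close> is then impossible.\<close>
  define e where "e = \<bar>vxy a - vyx a\<bar> / 2"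
  have "e > 0" using ne by (simp add: e_def)
  have "isCont vxy a" "isCont vyx a"
    using cxy cyx S a by (auto simp: continuous_on_eq_continuous_at)
  then obtain d1 d2 where d1: "d1 > 0" "\<And>z. dist z a < d1 \<Longrightarrow> dist (vxy z) (vxy a) < e"
    and d2: "d2 > 0" "\<And>z. dist z a < d2 \<Longrightarrow> dist (vyx z) (vyx a) < e"
    unfolding continuous_at_eps_delta using \<open>e > 0\<close> by metis
  obtain d3 where d3: "d3 > 0" "ball a d3 \<subseteq> S"
    using S a open_contains_ball by blast
  \<comment> \<open>Points of the square of side h lie within 2h of a, so a third of the least
    radius keeps them strictly inside all three balls.\<close>
  define h where "h = min d1 (min d2 d3) / 3"
  have hd: "3 * h \<le> d1" "3 * h \<le> d2" "3 * h \<le> d3"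
    by (auto simp: h_def)
  have h: "h > 0" using d1 d2 d3 by (auto simp: h_def)
  define P where "P = (\<lambda>x y. Complex (Re a + x) (Im a + y))"
  have dist: "dist (P x y) a < 3 * h" if "x \<in> {0..h}" "y \<in> {0..h}" for x y
  proof -
    have "dist (P x y) a \<le> \<bar>x\<bar> + \<bar>y\<bar>"
      unfolding dist_norm using cmod_le[of "P x y - a"] by (simp add: P_def)
    then show ?thesis using that h by auto
  qed
  have PS: "P x y \<in> S" if "x \<in> {0..h}" "y \<in> {0..h}" for x y
    using dist[OF that] d3 hd(3) by (auto simp: dist_commute subset_eq)
  have dx: "((\<lambda>t. f (P t y)) has_real_derivative p (P x y)) (at x)"
    and dy: "((\<lambda>t. f (P x t)) has_real_derivative q (P x y)) (at y)"
    if "x \<in> {0..h}" "y \<in> {0..h}"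
      "\<And>z. z \<in> S \<Longrightarrow> (f has_derivative (\<lambda>h. Re h * p z + Im h * q z)) (at z)" for f p q x y
    using DERIV_partials[OF that(3)[OF PS[OF that(1,2)], unfolded P_def]] by (simp_all add: P_def)
  let ?D = "v (P h h) - v (P h 0) - v (P 0 h) + v (P 0 0)"
  have "\<exists>x>0. x < h \<and> (v (P h h) - v (P h 0)) - (v (P 0 h) - v (P 0 0)) = (h - 0) * (vx (P x h) - vx (P x 0))"
    using h by (intro MVT2 DERIV_diff dx[OF _ _ v]) auto
  then obtain x where x: "0 < x" "x < h" "?D = h * (vx (P x h) - vx (P x 0))"
    by (auto simp: algebra_simps)
  have "\<exists>y>0. y < h \<and> vx (P x h) - vx (P x 0) = (h - 0) * vxy (P x y)"
    using h x by (intro MVT2 dy[OF _ _ vx]) auto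
  then obtain y where y: "0 < y" "y < h" "?D = h * h * vxy (P x y)"
    using x by auto
  have "\<exists>y>0. y < h \<and> (v (P h h) - v (P 0 h)) - (v (P h 0) - v (P 0 0)) = (h - 0) * (vy (P h y) - vy (P 0 y))"
    using h by (intro MVT2 DERIV_diff dy[OF _ _ v]) auto
  then obtain y' where y': "0 < y'" "y' < h" "?D = h * (vy (P h y') - vy (P 0 y'))"
    by (auto simp: algebra_simps)
  have "\<exists>x>0. x < h \<and> vy (P h y') - vy (P 0 y') = (h - 0) * vyx (P x y')"
    using h y' by (intro MVT2 dx[OF _ _ vy]) auto
  then obtain x' where x': "0 < x'" "x' < h" "?D = h * h * vyx (P x' y')"
    using y' by auto
  have eq: "vxy (P x y) = vyx (P x' y')"
    using y(3) x'(3) h by simp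
  have "dist (P x y) a < d1" "dist (P x' y') a < d2"
    using dist[of x y] dist[of x' y'] x(1,2) y(1,2) x'(1,2) y'(1,2) hd by auto
  then have "dist (vxy (P x y)) (vxy a) < e" "dist (vyx (P x' y')) (vyx a) < e"
    using d1 d2 by auto
  then show False
    using abs_triangle_ineq4[of "vyx (P x' y') - vyx a" "vyx (P x' y') - vxy a"]
    unfolding eq e_def dist_real_def by simp
qed

text \<open>The z-derivative h of u satisfies the Cauchy-Riemann equations: they amount to the
  Laplace equation together with the symmetry of the mixed partials. The disk is convex, so h has a
  primitive F; the remainder u - F has z-derivative 0 and is therefore conjugate
  holomorphic.\<close>

lemma harmonic_on_disk_decompose:
  assumes "harmonic_on u disk"
  obtains f g where "f holomorphic_on disk" "g holomorphic_on disk"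
    "\<And>z. z \<in> disk \<Longrightarrow> u z = f z + cnj (g z)"
proof -
  obtain ux uy uxx uxy uyx uyy where
    u: "has_partials_on u ux uy disk" and ux: "has_partials_on ux uxx uxy disk"
    and uy: "has_partials_on uy uyx uyy disk"
    and cxy: "continuous_on disk uxy" and cyx: "continuous_on disk uyx"
    and lap: "\<And>z. z \<in> disk \<Longrightarrow> uxx z + uyy z = 0"
    using assms unfolding harmonic_on_def by blast
  \<comment> \<open>\<open>harmonic_on\<close> names the two mixed partials separately. Their
    equality is obtained for real and imaginary parts, since the mean value theorem is a real
    statement.\<close>
  have mixed: "uxy z = uyx z" if z: "z \<in> disk" for z
  proof (rule complex_eqI)
    have R: "((\<lambda>z. Re (f z)) has_derivative (\<lambda>h. Re h * Re (p z) + Im h * Re (q z))) (at z)"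
      if "has_partials_on f p q disk" "z \<in> disk" for f p q z
      using has_derivative_Re[of f _ "at z"] that by (fastforce simp: has_partials_on_def)
    show "Re (uxy z) = Re (uyx z)"
      by (rule mixed_partials_eq[OF open_ball z R[OF u] R[OF ux] R[OF uy]])
         (auto intro!: continuous_intros cxy cyx)
    have I: "((\<lambda>z. Im (f z)) has_derivative (\<lambda>h. Re h * Im (p z) + Im h * Im (q z))) (at z)"
      if "has_partials_on f p q disk" "z \<in> disk" for f p q z
      using has_derivative_Im[of f _ "at z"] that by (fastforce simp: has_partials_on_def)
    show "Im (uxy z) = Im (uyx z)"
      by (rule mixed_partials_eq[OF open_ball z I[OF u] I[OF ux] I[OF uy]])
         (auto intro!: continuous_intros cxy cyx)
  qed
  \<comment> \<open>The Wirtinger derivative of u; for u = f + cnj g it is f'.\<close>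
  define h where "h = (\<lambda>z. 1 / 2 * (ux z - \<i> * uy z))"
  have "(h has_field_derivative (uxx z - \<i> * uyx z) / 2) (at z)" if z: "z \<in> disk" for z
  proof -
    have "(h has_derivative (\<lambda>k. 1 / 2 * ((Re k *\<^sub>R uxx z + Im k *\<^sub>R uxy z) - \<i> * (Re k *\<^sub>R uyx z + Im k *\<^sub>R uyy z)))) (at z)"
      unfolding h_def using ux uy z
      by (intro has_derivative_diff has_derivative_mult_right)
         (auto simp: has_partials_on_def)
    moreover have "uyy z = - uxx z"
      using lap[OF z] by (simp add: add_eq_0_iff)
    then have "(\<lambda>k. 1 / 2 * ((Re k *\<^sub>R uxx z + Im k *\<^sub>R uxy z) - \<i> * (Re k *\<^sub>R uyx z + Im k *\<^sub>R uyy z)))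
        = (\<lambda>k. (uxx z - \<i> * uyx z) / 2 * k)"
      by (auto simp: fun_eq_iff complex_eq_iff mixed[OF z] algebra_simps diff_divide_distrib add_divide_distrib)
    ultimately show ?thesis
      by (simp only: has_field_derivative_def)
  qed
  then have "h holomorphic_on disk"
    unfolding holomorphic_on_open[OF open_ball] by blast
  then obtain F where F': "\<And>z. z \<in> disk \<Longrightarrow> (F has_field_derivative h z) (at z within disk)"
    using holomorphic_convex_primitive'[of disk h] by auto
  have F: "(F has_field_derivative h z) (at z)" if "z \<in> disk" for z
    using F'[OF that] unfolding at_within_open[OF that open_ball] .
  \<comment> \<open>The differential of u at k is h k + (ux + i uy)/2 times \<open>cnj k\<close>.
    Subtracting F removes the first summand, and conjugation makes the second complex
    linear.\<close>
  have "((\<lambda>z. cnj (u z - F z)) has_field_derivative cnj ((ux z + \<i> * uy z) / 2)) (at z)" if z: "z \<in> disk" for z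
  proof -
    have "((\<lambda>z. cnj (u z - F z)) has_derivative (\<lambda>k. cnj ((Re k *\<^sub>R ux z + Im k *\<^sub>R uy z) - h z * k))) (at z)"
      using u F[OF z] z
      by (intro has_derivative_cnj has_derivative_diff)
         (auto simp: has_partials_on_def has_field_derivative_def)
    moreover have "(\<lambda>k. cnj ((Re k *\<^sub>R ux z + Im k *\<^sub>R uy z) - h z * k))
        = (\<lambda>k. cnj ((ux z + \<i> * uy z) / 2) * k)"
      by (auto simp: fun_eq_iff complex_eq_iff h_def field_simps)
    ultimately show ?thesis
      by (simp only: has_field_derivative_def)
  qed
  then have "(\<lambda>z. cnj (u z - F z)) holomorphic_on disk"
    unfolding holomorphic_on_open[OF open_ball] by blast
  moreover have "F holomorphic_on disk"
    unfolding holomorphic_on_open[OF open_ball] using F by blast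
  ultimately show ?thesis
    using that[of F "\<lambda>z. cnj (u z - F z)"] by simp
qed

section \<open>The reproducing kernel\<close>

lemma summable_Suc_mult_power:
  fixes x :: real
  assumes "\<bar>x\<bar> < 1"
  shows "summable (\<lambda>n. of_nat (Suc n) * x ^ n)"
  using geometric_deriv_sums[of x] assms by (auto simp: sums_iff)

text \<open>1/(1-x)^2 is the sum of (n+1) x^n, and |h| <= 1 gives the summable majorant (n+1) |z|^n
  |F|, so the series may be integrated termwise. With h the conjugation or the identity this handles
  either half of the kernel.\<close>

lemma integral_geometric_deriv_sums:
  fixes F h :: "complex \<Rightarrow> complex"
  assumes F: "integrable area_measure F" and z: "z \<in> disk"
    and h: "h \<in> borel_measurable borel" and h1: "\<And>w. w \<in> disk \<Longrightarrow> cmod (h w) \<le> 1"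
  shows "integrable area_measure (\<lambda>w. F w * (1 / (1 - z * h w)\<^sup>2))"
    and "(\<lambda>n. of_nat (Suc n) * z ^ n * (LINT w|area_measure. F w * h w ^ n)) sums
      (LINT w|area_measure. F w * (1 / (1 - z * h w)\<^sup>2))"
proof -
  have z1: "cmod z < 1" using z by simp
  have sm: "summable (\<lambda>n. of_nat (Suc n) * cmod z ^ n)"
    using z1 by (intro summable_Suc_mult_power) simp
  have hm: "h \<in> borel_measurable area_measure"
    using h by (rule borel_measurable_area_measure)
  have Fm: "F \<in> borel_measurable area_measure"
    using F by simp
  define G where "G = (\<lambda>n w. F w * (of_nat (Suc n) * (z * h w) ^ n))"
  have Gm: "G n \<in> borel_measurable area_measure" for n
    unfolding G_def using hm Fm by measurable
  have bound: "norm (G n w) \<le> of_nat (Suc n) * cmod z ^ n * norm (F w)" if "w \<in> disk" for n w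
  proof -
    have "cmod (h w) ^ n \<le> 1" using h1[OF that] by (simp add: power_le_one)
    then have "norm (F w) * (of_nat (Suc n) * cmod z ^ n) * cmod (h w) ^ n \<le> norm (F w) * (of_nat (Suc n) * cmod z ^ n) * 1"
      by (intro mult_left_mono) auto
    then show ?thesis
      unfolding G_def norm_mult norm_power norm_of_nat power_mult_distrib by (simp only: ac_simps mult_1_right)
  qed
  have bI: "integrable area_measure (\<lambda>w. of_nat (Suc n) * cmod z ^ n * norm (F w))" for n
    using F by (intro integrable_mult_right integrable_norm)
  have Gi: "integrable area_measure (G n)" for n
    by (rule Bochner_Integration.integrable_bound[OF bI[of n] Gm])
       (use AE_disk in eventually_elim, use bound in \<open>fastforce simp del: of_nat_Suc\<close>)
  have sn: "AE w in area_measure. summable (\<lambda>n. norm (G n w))"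
    using AE_disk
  proof eventually_elim
    case (elim w)
    show ?case
      by (rule summable_comparison_test'[OF summable_mult2[OF sm, of "norm (F w)"], of 0])
         (use bound[OF elim] in simp)
  qed
  have si: "summable (\<lambda>n. LINT w|area_measure. norm (G n w))"
  proof (rule summable_comparison_test'[OF summable_mult2[OF sm, of "LINT w|area_measure. norm (F w)"], of 0])
    fix n
    have "(LINT w|area_measure. norm (G n w)) \<le> (LINT w|area_measure. of_nat (Suc n) * cmod z ^ n * norm (F w))"
      by (intro integral_mono_AE integrable_norm Gi bI)
         (use AE_disk in eventually_elim, use bound in blast)
    also have "\<dots> = of_nat (Suc n) * cmod z ^ n * (LINT w|area_measure. norm (F w))"
      by (rule integral_mult_right_zero)
    finally show "norm (LINT w|area_measure. norm (G n w)) \<le> of_nat (Suc n) * cmod z ^ n * (LINT w|area_measure. norm (F w))"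
      by simp
  qed
  have AE: "AE w in area_measure. (\<Sum>n. G n w) = F w * (1 / (1 - z * h w)\<^sup>2)"
    using AE_disk
  proof eventually_elim
    case (elim w)
    have "cmod z * cmod (h w) \<le> cmod z * 1"
      using h1[OF elim] by (intro mult_left_mono) auto
    then have "norm (z * h w) < 1"
      using z1 by (simp add: norm_mult)
    from sums_mult[OF geometric_deriv_sums[OF this], of "F w"]
    show ?case by (simp add: G_def sums_iff)
  qed
  have m: "(\<lambda>w. F w * (1 / (1 - z * h w)\<^sup>2)) \<in> borel_measurable area_measure"
    using hm Fm by measurable
  have m': "(\<lambda>w. \<Sum>n. G n w) \<in> borel_measurable area_measure"
    using integrable_suminf[OF Gi sn si] by simp
  show "integrable area_measure (\<lambda>w. F w * (1 / (1 - z * h w)\<^sup>2))"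
    using integrable_suminf[OF Gi sn si] integrable_cong_AE[OF m m' ] AE by (simp add: eq_commute)
  have "(LINT w|area_measure. G n w) = of_nat (Suc n) * z ^ n * (LINT w|area_measure. F w * h w ^ n)" for n
  proof -
    have "G n = (\<lambda>w. of_nat (Suc n) * z ^ n * (F w * h w ^ n))"
      unfolding G_def power_mult_distrib by (simp only: ac_simps)
    then show ?thesis by (simp only: integral_mult_right_zero)
  qed
  moreover have "(LINT w|area_measure. (\<Sum>n. G n w)) = (LINT w|area_measure. F w * (1 / (1 - z * h w)\<^sup>2))"
    by (rule integral_cong_AE[OF m' m AE])
  ultimately show "(\<lambda>n. of_nat (Suc n) * z ^ n * (LINT w|area_measure. F w * h w ^ n)) sums
      (LINT w|area_measure. F w * (1 / (1 - z * h w)\<^sup>2))"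
    using sums_integral[OF Gi sn si] by (simp only:)
qed

section \<open>Integrals against the closed form of the kernel\<close>

text \<open>The analytic Bergman kernel plus its conjugate; the constants are reproduced by both,
  hence the correction -1.\<close>

definition kernel_fun :: "complex \<Rightarrow> complex \<Rightarrow> complex" where
  "kernel_fun z w = 1 / (1 - z * cnj w)\<^sup>2 + 1 / (1 - cnj z * w)\<^sup>2 - 1"

lemma cnj_kernel_fun: "cnj (kernel_fun z w) = kernel_fun z w"
  by (simp add: kernel_fun_def)

text \<open>By \<open>F0\<close> the second half of the kernel contributes only its constant term,
  the integral of F, which the -1 cancels. What remains is the series of the first half.\<close>

lemma integral_mult_kernel_fun:
  assumes F: "integrable area_measure F" and z: "z \<in> disk"
    and F0: "\<And>n. n \<ge> 1 \<Longrightarrow> (LINT w|area_measure. F w * w ^ n) = 0"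
  shows "integrable area_measure (\<lambda>w. F w * kernel_fun z w)"
    and "(\<lambda>n. of_nat (Suc n) * z ^ n * (LINT w|area_measure. F w * cnj w ^ n)) sums
      (LINT w|area_measure. F w * kernel_fun z w)"
proof -
  have cz: "cnj z \<in> disk" using z by simp
  have cm: "cnj \<in> borel_measurable borel"
    by (intro borel_measurable_continuous_onI continuous_intros)
  note 1 = integral_geometric_deriv_sums[OF F z cm]
  note 2 = integral_geometric_deriv_sums[OF F cz, of "\<lambda>w. w"]
  have i1: "integrable area_measure (\<lambda>w. F w * (1 / (1 - z * cnj w)\<^sup>2))"
    by (rule 1) auto
  have i2: "integrable area_measure (\<lambda>w. F w * (1 / (1 - cnj z * w)\<^sup>2))"
    by (rule 2) auto
  have eq: "(\<lambda>w. F w * kernel_fun z w) = (\<lambda>w. F w * (1 / (1 - z * cnj w)\<^sup>2) + F w * (1 / (1 - cnj z * w)\<^sup>2) - F w)"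
    unfolding kernel_fun_def by (simp add: fun_eq_iff algebra_simps)
  show "integrable area_measure (\<lambda>w. F w * kernel_fun z w)"
    unfolding eq by (intro Bochner_Integration.integrable_diff Bochner_Integration.integrable_add i1 i2 F)
  have "(\<lambda>n. of_nat (Suc n) * cnj z ^ n * (LINT w|area_measure. F w * w ^ n)) sums
      (of_nat (Suc 0) * cnj z ^ 0 * (LINT w|area_measure. F w * w ^ 0))"
  proof (rule sums_single[THEN sums_cong[THEN iffD1, rotated], of 0])
    fix n :: nat
    show "(if n = 0 then of_nat (Suc n) * cnj z ^ n * (LINT w|area_measure. F w * w ^ n) else 0)
        = of_nat (Suc n) * cnj z ^ n * (LINT w|area_measure. F w * w ^ n)"
      using F0[of n] by (cases n) auto
  qed
  moreover have "(\<lambda>n. of_nat (Suc n) * cnj z ^ n * (LINT w|area_measure. F w * w ^ n)) sums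
      (LINT w|area_measure. F w * (1 / (1 - cnj z * w)\<^sup>2))"
    by (rule 2) auto
  ultimately have "(LINT w|area_measure. F w * (1 / (1 - cnj z * w)\<^sup>2)) = integral\<^sup>L area_measure F"
    by (simp add: sums_iff)
  then have "(LINT w|area_measure. F w * kernel_fun z w) = (LINT w|area_measure. F w * (1 / (1 - z * cnj w)\<^sup>2))"
    unfolding eq using i1 i2 F by simp
  moreover have "(\<lambda>n. of_nat (Suc n) * z ^ n * (LINT w|area_measure. F w * cnj w ^ n)) sums
      (LINT w|area_measure. F w * (1 / (1 - z * cnj w)\<^sup>2))"
    by (rule 1) auto
  ultimately show "(\<lambda>n. of_nat (Suc n) * z ^ n * (LINT w|area_measure. F w * cnj w ^ n)) sums
      (LINT w|area_measure. F w * kernel_fun z w)"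
    by simp
qed

text \<open>F has angular frequency q >= 0. Multiplying by w^n with n >= 1, or by
  \<open>cnj w ^ n\<close> with n different from q, leaves a nonzero frequency, and such integrals
  vanish by rotation; a single term of the series survives.\<close>

lemma integral_homogeneous_mult_kernel_fun:
  fixes F :: "complex \<Rightarrow> complex"
  assumes F: "integrable area_measure F" and z: "z \<in> disk"
    and rot: "\<And>t w. w \<noteq> 0 \<Longrightarrow> F (cis t * w) = cis (real q * t) * F w"
  shows "(LINT w|area_measure. F w * kernel_fun z w) = of_nat (Suc q) * z ^ q * (LINT w|area_measure. F w * cnj w ^ q)"
proof -
  have Fm: "F \<in> borel_measurable area_measure" using F by simp
  have idm: "(\<lambda>w. w) \<in> borel_measurable area_measure" and cm: "cnj \<in> borel_measurable area_measure"
    by (intro borel_measurable_area_measure borel_measurable_continuous_onI continuous_intros)+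
  have "(LINT w|area_measure. F w * w ^ n) = 0" if "n \<ge> 1" for n
  proof (rule integral_area_measure_eq_0[of _ "int (q + n)"])
    show "(\<lambda>w. F w * w ^ n) \<in> borel_measurable area_measure"
      using Fm idm by measurable
    show "F (cis t * w) * (cis t * w) ^ n = cis (of_int (int (q + n)) * t) * (F w * w ^ n)" if "w \<noteq> 0" for t w
      using rot[OF that, of t] by (simp add: power_mult_distrib Complex.DeMoivre algebra_simps cis_mult)
  qed (use that in auto)
  note * = integral_mult_kernel_fun(2)[OF F z this]
  have 0: "(LINT w|area_measure. F w * cnj w ^ n) = 0" if "n \<noteq> q" for n
  proof (rule integral_area_measure_eq_0[of _ "int q - int n"])
    show "(\<lambda>w. F w * cnj w ^ n) \<in> borel_measurable area_measure"
      using Fm cm by measurable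
    show "F (cis t * w) * cnj (cis t * w) ^ n = cis (of_int (int q - int n) * t) * (F w * cnj w ^ n)" if "w \<noteq> 0" for t w
      using rot[OF that, of t] by (simp add: power_mult_distrib cis_cnj Complex.DeMoivre algebra_simps cis_mult)
  qed (use that in auto)
  have "(\<lambda>n. of_nat (Suc n) * z ^ n * (LINT w|area_measure. F w * cnj w ^ n)) sums
      (of_nat (Suc q) * z ^ q * (LINT w|area_measure. F w * cnj w ^ q))"
  proof (rule sums_single[THEN sums_cong[THEN iffD1, rotated], of q])
    fix n :: nat
    show "(if n = q then of_nat (Suc n) * z ^ n * (LINT w|area_measure. F w * cnj w ^ n) else 0)
        = of_nat (Suc n) * z ^ n * (LINT w|area_measure. F w * cnj w ^ n)"
      using 0[of n] by auto
  qed
  with * show ?thesis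
    by (simp only: sums_iff)
qed

lemma integral_radial_power:
  assumes "0 \<le> \<rho>" "\<rho> \<le> 1"
  shows "(LINT r|radial_measure. indicator {0..<\<rho>} r *\<^sub>R complex_of_real (r ^ j)) = of_real (\<rho> ^ (j + 2) / (j + 2))"
proof -
  have bm: "(\<lambda>r. indicator {0..<\<rho>} r *\<^sub>R complex_of_real (r ^ j)) \<in> borel_measurable radial_measure"
    unfolding borel_measurable_radial_measure_iff
    by (intro measurable_restrict_space1) (rule measurable_completion, measurable)
  have "(LINT r|radial_measure. indicator {0..<\<rho>} r *\<^sub>R complex_of_real (r ^ j))
      = (LINT r|lebesgue. indicator {0..<1} r *\<^sub>R (r *\<^sub>R indicator {0..<\<rho>} r *\<^sub>R complex_of_real (r ^ j)))"
    by (rule integral_radial_measure[OF bm])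
  also have "\<dots> = (LINT r|lborel. indicator {0..<1} r *\<^sub>R (r *\<^sub>R indicator {0..<\<rho>} r *\<^sub>R complex_of_real (r ^ j)))"
    by (subst integral_completion) auto
  also have "\<dots> = (LINT r|lborel. indicator {0..\<rho>} r *\<^sub>R complex_of_real (r ^ (j + 1)))"
  proof (rule integral_cong_AE)
    show "AE r in lborel. indicator {0..<1} r *\<^sub>R (r *\<^sub>R indicator {0..<\<rho>} r *\<^sub>R complex_of_real (r ^ j))
        = indicator {0..\<rho>} r *\<^sub>R complex_of_real (r ^ (j + 1))"
      using AE_lborel_singleton[of \<rho>] by eventually_elim (use assms in \<open>auto simp: indicator_def scaleR_conv_of_real\<close>)
  qed auto
  also have "\<dots> = of_real (\<rho> ^ (j + 2) / (j + 2)) - of_real (0 ^ (j + 2) / (j + 2))"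
  proof (rule integral_FTC_Icc)
    fix x :: real
    have "((\<lambda>x. x ^ (j + 2) / (j + 2)) has_real_derivative x ^ (j + 1)) (at x within {0..\<rho>})"
      by (auto intro!: derivative_eq_intros simp: divide_simps simp del: power_Suc)
    then have "((\<lambda>x. of_real (x ^ (j + 2) / (j + 2))) has_vector_derivative complex_of_real (x ^ (j + 1))) (at x within {0..\<rho>})"
      by (intro has_vector_derivative_of_real) (simp add: has_real_derivative_iff_has_vector_derivative)
    then show "((\<lambda>x. complex_of_real (x ^ (j + 2) / real (j + 2))) has_vector_derivative complex_of_real (x ^ (j + 1))) (at x within {0..\<rho>})"
      by simp
  qed (use assms in \<open>auto intro!: continuous_intros\<close>)
  finally show ?thesis by simp
qed

lemma kernel_fun_bounded:
  assumes "z \<in> disk"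
  shows "\<exists>C\<ge>0. \<forall>w\<in>disk. cmod (kernel_fun z w) \<le> C"
proof (intro exI conjI ballI)
  let ?C = "2 / (1 - cmod z)\<^sup>2 + 1"
  show "?C \<ge> 0" by simp
  fix w assume w: "w \<in> disk"
  have z1: "cmod z < 1" using assms by simp
  have *: "cmod (1 / (1 - x)\<^sup>2) \<le> 1 / (1 - cmod z)\<^sup>2" if "cmod x \<le> cmod z" for x
  proof -
    have "1 - cmod z \<le> cmod (1 - x)"
      using that norm_triangle_ineq2[of 1 x] by simp
    then have "(1 - cmod z)\<^sup>2 \<le> (cmod (1 - x))\<^sup>2"
      using z1 by (intro power_mono) auto
    moreover have "(1 - cmod z)\<^sup>2 > 0"
      using z1 by simp
    ultimately show ?thesis
      unfolding norm_divide norm_power norm_one by (intro divide_left_mono mult_pos_pos) auto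
  qed
  have "cmod z * cmod w \<le> cmod z"
    using w by (intro mult_right_le_one_le) auto
  then have "cmod (1 / (1 - z * cnj w)\<^sup>2) \<le> 1 / (1 - cmod z)\<^sup>2" "cmod (1 / (1 - cnj z * w)\<^sup>2) \<le> 1 / (1 - cmod z)\<^sup>2"
    by (intro *; simp add: norm_mult)+
  then show "cmod (kernel_fun z w) \<le> ?C"
    unfolding kernel_fun_def
    using norm_triangle_ineq4[of "1 / (1 - z * cnj w)\<^sup>2 + 1 / (1 - cnj z * w)\<^sup>2" 1]
      norm_triangle_ineq[of "1 / (1 - z * cnj w)\<^sup>2" "1 / (1 - cnj z * w)\<^sup>2"]
    by simp
qed

lemma kernel_fun_measurable: "kernel_fun z \<in> borel_measurable area_measure"
proof -
  have [measurable]: "cnj \<in> borel_measurable borel"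
    by (intro borel_measurable_continuous_onI continuous_intros)
  show ?thesis
    unfolding kernel_fun_def by (intro borel_measurable_area_measure) measurable
qed

lemma integrable_area_measure_bounded:
  fixes f :: "complex \<Rightarrow> 'a::euclidean_space"
  assumes "f \<in> borel_measurable area_measure" "\<And>w. w \<in> disk \<Longrightarrow> norm (f w) \<le> C"
  shows "integrable area_measure f"
proof -
  interpret finite_measure area_measure
    by (rule finite_measure_area_measure)
  show ?thesis
    by (rule integrable_const_bound[of _ C]) (use AE_disk assms in \<open>auto elim!: eventually_mono\<close>)
qed

lemma borel_measurable_ball_power:
  "(\<lambda>w. indicator (ball 0 \<rho>) w *\<^sub>R w ^ k) \<in> borel_measurable (borel :: complex measure)"
  by (intro borel_measurable_scaleR borel_measurable_indicator borel_measurable_power) auto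

text \<open>Truncation at radius \<rho> multiplies the reproduced z^k by \<rho>^(2k+2). It is
  written as a factor \<rho>^2 and a dilation of z by \<rho>^2, so that Taylor series can be
  summed.\<close>

lemma integral_power_mult_kernel_fun:
  assumes "0 \<le> \<rho>" "\<rho> \<le> 1" and z: "z \<in> disk"
  shows "(LINT w|area_measure. (indicator (ball 0 \<rho>) w *\<^sub>R w ^ k) * kernel_fun z w) = of_real (\<rho>\<^sup>2) * (of_real (\<rho>\<^sup>2) * z) ^ k"
proof -
  let ?F = "\<lambda>w::complex. indicator (ball 0 \<rho>) w *\<^sub>R w ^ k :: complex"
  have cm: "(\<lambda>w. cnj w ^ k) \<in> borel_measurable borel"
    by (intro borel_measurable_continuous_onI continuous_intros)
  have Fm: "?F \<in> borel_measurable borel"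
    by (rule borel_measurable_ball_power)
  have Fi: "integrable area_measure ?F"
    by (rule integrable_area_measure_bounded[OF borel_measurable_area_measure[OF Fm], of 1])
       (auto simp: indicator_def norm_power power_le_one)
  have "(LINT w|area_measure. ?F w * kernel_fun z w) = of_nat (Suc k) * z ^ k * (LINT w|area_measure. ?F w * cnj w ^ k)"
    by (rule integral_homogeneous_mult_kernel_fun[OF Fi z])
       (auto simp: indicator_def norm_mult power_mult_distrib Complex.DeMoivre)
  also have "(LINT w|area_measure. ?F w * cnj w ^ k) = 2 * (LINT r|radial_measure. indicator {0..<\<rho>} r *\<^sub>R complex_of_real (r ^ (2 * k)))"
  proof (rule integral_area_measure_radial)
    show "(\<lambda>w. ?F w * cnj w ^ k) \<in> borel_measurable area_measure"
      by (intro borel_measurable_area_measure borel_measurable_times Fm cm)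
    show "(\<lambda>r. indicator {0..<\<rho>} r *\<^sub>R complex_of_real (r ^ (2 * k))) \<in> borel_measurable radial_measure"
      unfolding borel_measurable_radial_measure_iff
      by (intro measurable_restrict_space1) (rule measurable_completion, measurable)
    show "AE w in area_measure. ?F w * cnj w ^ k = indicator {0..<\<rho>} (cmod w) *\<^sub>R complex_of_real (cmod w ^ (2 * k))"
    proof (intro always_eventually allI)
      fix w :: complex
      have "complex_of_real (cmod w ^ (2 * k)) = (w * cnj w) ^ k"
        unfolding power_mult of_real_power[of "(cmod w)\<^sup>2" k] complex_norm_square ..
      then show "?F w * cnj w ^ k = indicator {0..<\<rho>} (cmod w) *\<^sub>R complex_of_real (cmod w ^ (2 * k))"
        by (simp add: indicator_def power_mult_distrib)
    qed
  qed
  also have "\<dots> = 2 * of_real (\<rho> ^ (2 * k + 2) / (2 * k + 2))"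
    using assms by (subst integral_radial_power) auto
  also have "of_nat (Suc k) * z ^ k * (2 * complex_of_real (\<rho> ^ (2 * k + 2) / (2 * k + 2)))
      = of_real (real (Suc k) * (2 * (\<rho> ^ (2 * k + 2) / (2 * k + 2)))) * z ^ k"
    by (simp only: of_real_mult of_real_of_nat_eq of_real_numeral mult_ac)
  also have "real (Suc k) * (2 * (\<rho> ^ (2 * k + 2) / (2 * k + 2))) = \<rho>\<^sup>2 * (\<rho>\<^sup>2) ^ k"
  proof -
    have "real (2 * k + 2) = 2 * real (Suc k)" by simp
    moreover have "\<rho> ^ (2 * k + 2) = \<rho>\<^sup>2 * (\<rho>\<^sup>2) ^ k"
      unfolding power_add power_mult by (rule mult.commute)
    ultimately show ?thesis
      by (simp del: of_nat_Suc of_nat_add)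
  qed
  finally show ?thesis
    by (simp add: power_mult_distrib)
qed

text \<open>No integrability of f on the whole disk is assumed; on the ball of radius \<rho> < 1 its
  Taylor series has a summable majorant and may be integrated termwise against the bounded
  kernel.\<close>

lemma integral_holomorphic_mult_kernel_fun:
  assumes \<rho>: "0 < \<rho>" "\<rho> < 1" and z: "z \<in> disk" and f: "f holomorphic_on disk"
  shows "integrable area_measure (\<lambda>w. (indicator (ball 0 \<rho>) w *\<^sub>R f w) * kernel_fun z w)"
    and "(LINT w|area_measure. (indicator (ball 0 \<rho>) w *\<^sub>R f w) * kernel_fun z w) = of_real (\<rho>\<^sup>2) * f (of_real (\<rho>\<^sup>2) * z)"
proof -
  define a where "a = (\<lambda>k. (deriv ^^ k) f 0 / fact k)"
  have sums: "(\<lambda>k. a k * w ^ k) sums f w" if "w \<in> disk" for w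
    using holomorphic_power_series[OF f that] by (simp add: a_def)
  obtain C where C: "C \<ge> 0" "\<And>w. w \<in> disk \<Longrightarrow> cmod (kernel_fun z w) \<le> C"
    using kernel_fun_bounded[OF z] by blast
  \<comment> \<open>Convergence at a radius strictly between \<rho> and 1 gives absolute convergence
    at \<rho>.\<close>
  define \<sigma> where "\<sigma> = (1 + \<rho>) / 2"
  have \<sigma>: "\<rho> < \<sigma>" "\<sigma> < 1" using \<rho> by (auto simp: \<sigma>_def)
  have "of_real \<sigma> \<in> disk" using \<sigma> \<rho> by simp
  then have "summable (\<lambda>k. a k * of_real \<sigma> ^ k)"
    using sums by (auto simp: sums_iff)
  then have sm: "summable (\<lambda>k. cmod (a k * of_real \<rho> ^ k))"
    by (rule powser_insidea) (use \<sigma> \<rho> in auto)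
  define G where "G = (\<lambda>k w. a k * ((indicator (ball 0 \<rho>) w *\<^sub>R w ^ k) * kernel_fun z w))"
  have bound: "norm (G k w) \<le> cmod (a k * of_real \<rho> ^ k) * C" if "w \<in> disk" for k w
  proof (cases "w \<in> ball 0 \<rho>")
    case True
    then have "cmod w ^ k \<le> \<rho> ^ k" by (intro power_mono) auto
    then have "cmod (a k) * cmod w ^ k * cmod (kernel_fun z w) \<le> cmod (a k) * \<rho> ^ k * C"
      using C that \<rho> by (intro mult_mono mult_left_mono) auto
    then show ?thesis
      using True \<rho> by (simp add: G_def norm_mult norm_power mult_ac)
  qed (use C in \<open>auto simp: G_def\<close>)
  have Gm: "G k \<in> borel_measurable area_measure" for k
  proof -
    have "(\<lambda>w. indicator (ball 0 \<rho>) w *\<^sub>R w ^ k) \<in> borel_measurable area_measure"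
      by (intro borel_measurable_area_measure borel_measurable_ball_power)
    then show ?thesis
      unfolding G_def using kernel_fun_measurable[of z] by measurable
  qed
  have Gi: "integrable area_measure (G k)" for k
    using Gm bound by (rule integrable_area_measure_bounded)
  have sn: "AE w in area_measure. summable (\<lambda>k. norm (G k w))"
    using AE_disk
  proof eventually_elim
    case (elim w)
    show ?case
      by (rule summable_comparison_test'[OF summable_mult2[OF sm, of C], of 0]) (use bound[OF elim] in simp)
  qed
  have si: "summable (\<lambda>k. LINT w|area_measure. norm (G k w))"
  proof (rule summable_comparison_test'[OF summable_mult2[OF sm, of "C * measure area_measure (space area_measure)"], of 0])
    fix k
    have "(LINT w|area_measure. norm (G k w)) \<le> (LINT w|area_measure. cmod (a k * of_real \<rho> ^ k) * C)"
      by (intro integral_mono_AE integrable_norm Gi integrable_area_measure_bounded[of _ "norm (cmod (a k * of_real \<rho> ^ k) * C)"])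
         (use AE_disk bound in \<open>auto elim!: eventually_mono\<close>)
    then show "norm (LINT w|area_measure. norm (G k w)) \<le> cmod (a k * of_real \<rho> ^ k) * (C * measure area_measure (space area_measure))"
      by (simp add: mult_ac)
  qed
  have suminf: "(\<Sum>k. G k w) = (indicator (ball 0 \<rho>) w *\<^sub>R f w) * kernel_fun z w" for w
  proof (cases "w \<in> ball 0 \<rho>")
    case True
    then have "w \<in> disk" using \<rho> by auto
    from sums_mult2[OF sums[OF this], of "kernel_fun z w"] show ?thesis
      using True by (simp add: G_def sums_iff mult_ac)
  qed (simp add: G_def)
  show "integrable area_measure (\<lambda>w. (indicator (ball 0 \<rho>) w *\<^sub>R f w) * kernel_fun z w)"
    using integrable_suminf[OF Gi sn si] unfolding suminf .
  have "(LINT w|area_measure. G k w) = of_real (\<rho>\<^sup>2) * (a k * (of_real (\<rho>\<^sup>2) * z) ^ k)" for k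
    unfolding G_def integral_mult_right_zero
    using integral_power_mult_kernel_fun[of \<rho> z k] \<rho> z by (simp add: mult_ac)
  moreover have "of_real (\<rho>\<^sup>2) * z \<in> disk"
  proof -
    have "\<rho>\<^sup>2 * cmod z \<le> 1 * cmod z"
      using \<rho> by (intro mult_right_mono) (auto simp: power_le_one)
    then show ?thesis using z by (simp add: norm_mult norm_power)
  qed
  ultimately have "(\<lambda>k. LINT w|area_measure. G k w) sums (of_real (\<rho>\<^sup>2) * f (of_real (\<rho>\<^sup>2) * z))"
    by (simp only:) (intro sums_mult sums)
  with sums_integral[OF Gi sn si]
  show "(LINT w|area_measure. (indicator (ball 0 \<rho>) w *\<^sub>R f w) * kernel_fun z w) = of_real (\<rho>\<^sup>2) * f (of_real (\<rho>\<^sup>2) * z)"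
    unfolding suminf by (simp only: sums_iff)
qed

section \<open>Members of the harmonic Bergman space and the reproducing property\<close>

lemma harmonic_bergmanD:
  assumes "u \<in> harmonic_bergman"
  shows "harmonic_on u disk" "\<And>z. z \<notin> disk \<Longrightarrow> u z = 0" "integrable area_measure (\<lambda>z. (cmod (u z))\<^sup>2)"
  using assms by (auto simp: harmonic_bergman_def)

lemma harmonic_on_disk_continuous:
  assumes "harmonic_on u disk"
  shows "continuous_on disk u"
proof -
  obtain f g where fg: "f holomorphic_on disk" "g holomorphic_on disk"
    "\<And>z. z \<in> disk \<Longrightarrow> u z = f z + cnj (g z)"
    using harmonic_on_disk_decompose[OF assms] by blast
  have "continuous_on disk (\<lambda>z. f z + cnj (g z))"
    by (intro continuous_intros holomorphic_on_imp_continuous_on fg)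
  then show ?thesis
    by (rule continuous_on_eq) (use fg in auto)
qed

lemma harmonic_bergman_measurable:
  assumes "u \<in> harmonic_bergman"
  shows "u \<in> borel_measurable area_measure"
proof (rule borel_measurable_area_measure)
  have "(\<lambda>z. indicator disk z *\<^sub>R u z) \<in> borel_measurable borel"
    using harmonic_on_disk_continuous harmonic_bergmanD(1)[OF assms]
    by (intro borel_measurable_continuous_on_indicator) auto
  moreover have "(\<lambda>z. indicator disk z *\<^sub>R u z) = u"
    using harmonic_bergmanD(2)[OF assms] by (auto simp: fun_eq_iff indicator_def)
  ultimately show "u \<in> borel_measurable borel" by simp
qed

lemma integrable_mult_harmonic_bergman:
  assumes "u \<in> harmonic_bergman" "v \<in> harmonic_bergman"
  shows "integrable area_measure (\<lambda>w. u w * cnj (v w))"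
proof (rule Bochner_Integration.integrable_bound)
  show "integrable area_measure (\<lambda>w. (cmod (u w))\<^sup>2 + (cmod (v w))\<^sup>2)"
    by (intro Bochner_Integration.integrable_add harmonic_bergmanD assms)
  have [measurable]: "cnj \<in> borel_measurable borel"
    by (intro borel_measurable_continuous_onI continuous_intros)
  show "(\<lambda>w. u w * cnj (v w)) \<in> borel_measurable area_measure"
    using assms[THEN harmonic_bergman_measurable] by measurable
  have "x * y \<le> x\<^sup>2 + y\<^sup>2" if "0 \<le> x" "0 \<le> y" for x y :: real
    using sum_squares_bound[of x y] mult_nonneg_nonneg[OF that] by linarith
  then show "AE w in area_measure. norm (u w * cnj (v w)) \<le> norm ((cmod (u w))\<^sup>2 + (cmod (v w))\<^sup>2)"
    by (intro always_eventually) (auto simp: norm_mult abs_of_nonneg)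
qed

lemma bounded_harmonic_in_harmonic_bergman:
  assumes "f holomorphic_on disk" "g holomorphic_on disk"
    and u: "\<And>z. z \<in> disk \<Longrightarrow> u z = f z + cnj (g z)" "\<And>z. z \<notin> disk \<Longrightarrow> u z = 0"
    and b: "\<And>z. z \<in> disk \<Longrightarrow> cmod (u z) \<le> C"
  shows "u \<in> harmonic_bergman"
proof -
  have h: "harmonic_on u disk"
    by (rule harmonic_on_holomorphic_add_cnj[OF open_ball assms(1,2) u(1)])
  have "(\<lambda>z. indicator disk z *\<^sub>R u z) \<in> borel_measurable borel"
    using harmonic_on_disk_continuous[OF h]
    by (intro borel_measurable_continuous_on_indicator) auto
  moreover have "(\<lambda>z. indicator disk z *\<^sub>R u z) = u"
    using u by (auto simp: fun_eq_iff indicator_def)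
  ultimately have "u \<in> borel_measurable borel" by simp
  then have "(\<lambda>z. (cmod (u z))\<^sup>2) \<in> borel_measurable area_measure"
    by (intro borel_measurable_area_measure) measurable
  then have "integrable area_measure (\<lambda>z. (cmod (u z))\<^sup>2)"
    by (rule integrable_area_measure_bounded[of _ "C\<^sup>2"]) (auto intro!: power_mono b)
  with h u show ?thesis
    by (simp add: harmonic_bergman_def)
qed

lemma harmonic_bergman_diff:
  assumes u: "u \<in> harmonic_bergman" and v: "v \<in> harmonic_bergman"
  shows "(\<lambda>z. u z - v z) \<in> harmonic_bergman"
proof -
  obtain f1 g1 where 1: "f1 holomorphic_on disk" "g1 holomorphic_on disk"
    "\<And>z. z \<in> disk \<Longrightarrow> u z = f1 z + cnj (g1 z)"
    using harmonic_on_disk_decompose harmonic_bergmanD(1)[OF u] by blast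
  obtain f2 g2 where 2: "f2 holomorphic_on disk" "g2 holomorphic_on disk"
    "\<And>z. z \<in> disk \<Longrightarrow> v z = f2 z + cnj (g2 z)"
    using harmonic_on_disk_decompose harmonic_bergmanD(1)[OF v] by blast
  have "harmonic_on (\<lambda>z. u z - v z) disk"
    by (rule harmonic_on_holomorphic_add_cnj[of _ "\<lambda>z. f1 z - f2 z" "\<lambda>z. g1 z - g2 z"])
       (use 1 2 in \<open>auto intro!: holomorphic_intros\<close>)
  moreover have "integrable area_measure (\<lambda>z. (cmod (u z - v z))\<^sup>2)"
  proof (rule Bochner_Integration.integrable_bound)
    show "integrable area_measure (\<lambda>z. 2 * (cmod (u z))\<^sup>2 + 2 * (cmod (v z))\<^sup>2)"
      by (intro Bochner_Integration.integrable_add integrable_mult_right harmonic_bergmanD u v)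
    show "(\<lambda>z. (cmod (u z - v z))\<^sup>2) \<in> borel_measurable area_measure"
      using harmonic_bergman_measurable[OF u] harmonic_bergman_measurable[OF v] by measurable
    have "(cmod (x - y))\<^sup>2 \<le> 2 * (cmod x)\<^sup>2 + 2 * (cmod y)\<^sup>2" for x y
    proof -
      have "(cmod (x - y))\<^sup>2 \<le> (cmod x + cmod y)\<^sup>2"
        by (intro power_mono norm_triangle_ineq4) auto
      also have "\<dots> \<le> 2 * (cmod x)\<^sup>2 + 2 * (cmod y)\<^sup>2"
        using sum_squares_bound[of "cmod x" "cmod y"] by (simp add: power2_sum)
      finally show ?thesis .
    qed
    then show "AE z in area_measure. norm ((cmod (u z - v z))\<^sup>2) \<le> norm (2 * (cmod (u z))\<^sup>2 + 2 * (cmod (v z))\<^sup>2)"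
      by (intro always_eventually) auto
  qed
  ultimately show ?thesis
    using harmonic_bergmanD(2)[OF u] harmonic_bergmanD(2)[OF v] by (simp add: harmonic_bergman_def)
qed

lemma integrable_harmonic_bergman:
  assumes "u \<in> harmonic_bergman"
  shows "integrable area_measure u"
proof (rule Bochner_Integration.integrable_bound)
  interpret finite_measure area_measure
    by (rule finite_measure_area_measure)
  show "integrable area_measure (\<lambda>w. (cmod (u w))\<^sup>2 + 1)"
    using harmonic_bergmanD(3)[OF assms] by simp
  show "u \<in> borel_measurable area_measure"
    by (rule harmonic_bergman_measurable[OF assms])
  have "x \<le> x\<^sup>2 + 1" if "0 \<le> x" for x :: real
    using sum_squares_bound[of x 1] that by simp
  then show "AE w in area_measure. norm (u w) \<le> norm ((cmod (u w))\<^sup>2 + 1)"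
    by (intro always_eventually) (auto simp: abs_of_nonneg)
qed

text \<open>On a ball of radius \<rho> < 1 the two parts of u can be integrated separately, giving
  \<rho>^2 u(\<rho>^2 z). As \<rho> tends to 1, the integrals converge by dominated convergence,
  because u is integrable and the kernel is bounded for fixed z; the values converge by continuity
  of u at z.\<close>

lemma kernel_fun_reproducing:
  assumes u: "u \<in> harmonic_bergman" and z: "z \<in> disk"
  shows "(LINT w|area_measure. u w * kernel_fun z w) = u z"
proof -
  obtain f g where fg: "f holomorphic_on disk" "g holomorphic_on disk"
    "\<And>z. z \<in> disk \<Longrightarrow> u z = f z + cnj (g z)"
    using harmonic_on_disk_decompose harmonic_bergmanD(1)[OF u] by blast
  \<comment> \<open>The shift by 2 keeps the radius positive already for n = 0.\<close>
  define \<rho> where "\<rho> = (\<lambda>n. 1 - 1 / real (n + 2))"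
  have \<rho>: "0 < \<rho> n" "\<rho> n < 1" for n
    by (auto simp: \<rho>_def)
  have lim: "\<rho> \<longlonglongrightarrow> 1"
    unfolding \<rho>_def by real_asymp
  let ?I = "\<lambda>n w. (indicator (ball 0 (\<rho> n)) w *\<^sub>R u w) * kernel_fun z w"
  have z\<rho>: "of_real ((\<rho> n)\<^sup>2) * z \<in> disk" for n
  proof -
    have "(\<rho> n)\<^sup>2 * cmod z \<le> 1 * cmod z"
      using \<rho>[of n] by (intro mult_right_mono) (auto simp: power_le_one)
    then show ?thesis using z by (simp add: norm_mult norm_power)
  qed
  have val: "integral\<^sup>L area_measure (?I n) = of_real ((\<rho> n)\<^sup>2) * u (of_real ((\<rho> n)\<^sup>2) * z)" for n
  proof -
    note F = integral_holomorphic_mult_kernel_fun[OF \<rho>[of n] z fg(1)]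
    note G = integral_holomorphic_mult_kernel_fun[OF \<rho>[of n] _ fg(2), of z]
    \<comment> \<open>The kernel is real, so the conjugate part of u contributes the conjugate of
      the integral for g.\<close>
    have "?I n w = (indicator (ball 0 (\<rho> n)) w *\<^sub>R f w) * kernel_fun z w
        + cnj ((indicator (ball 0 (\<rho> n)) w *\<^sub>R g w) * kernel_fun z w)" for w
      using fg(3)[of w] \<rho>[of n] by (auto simp: indicator_def cnj_kernel_fun algebra_simps)
    then have "integral\<^sup>L area_measure (?I n) =
       (LINT w|area_measure. (indicator (ball 0 (\<rho> n)) w *\<^sub>R f w) * kernel_fun z w)
       + (LINT w|area_measure. cnj ((indicator (ball 0 (\<rho> n)) w *\<^sub>R g w) * kernel_fun z w))"
      using F(1) G(1)[OF z] by (simp only: Bochner_Integration.integral_add integrable_cnj)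
    also have "(LINT w|area_measure. cnj ((indicator (ball 0 (\<rho> n)) w *\<^sub>R g w) * kernel_fun z w))
       = cnj (of_real ((\<rho> n)\<^sup>2) * g (of_real ((\<rho> n)\<^sup>2) * z))"
      unfolding G(2)[OF z, symmetric] by (rule Bochner_Integration.integral_cnj)
    also have "(LINT w|area_measure. (indicator (ball 0 (\<rho> n)) w *\<^sub>R f w) * kernel_fun z w)
        + cnj (of_real ((\<rho> n)\<^sup>2) * g (of_real ((\<rho> n)\<^sup>2) * z))
        = of_real ((\<rho> n)\<^sup>2) * u (of_real ((\<rho> n)\<^sup>2) * z)"
      unfolding F(2) fg(3)[OF z\<rho>] by (simp add: distrib_left)
    finally show ?thesis .
  qed
  obtain C where C: "C \<ge> 0" "\<And>w. w \<in> disk \<Longrightarrow> cmod (kernel_fun z w) \<le> C"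
    using kernel_fun_bounded[OF z] by blast
  have um: "u \<in> borel_measurable area_measure"
    by (rule harmonic_bergman_measurable[OF u])
  have "(\<lambda>n. integral\<^sup>L area_measure (?I n)) \<longlonglongrightarrow> (LINT w|area_measure. u w * kernel_fun z w)"
  proof (rule integral_dominated_convergence)
    show "(\<lambda>w. u w * kernel_fun z w) \<in> borel_measurable area_measure"
      using um kernel_fun_measurable[of z] by measurable
    show "?I n \<in> borel_measurable area_measure" for n
    proof -
      have "(indicator (ball 0 (\<rho> n)) :: complex \<Rightarrow> real) \<in> borel_measurable area_measure"
        by (intro borel_measurable_area_measure borel_measurable_indicator) auto
      then show ?thesis
        using um kernel_fun_measurable[of z] by measurable
    qed
    show "integrable area_measure (\<lambda>w. cmod (u w) * C)"
      using integrable_harmonic_bergman[OF u] by simp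
    show "AE w in area_measure. (\<lambda>n. ?I n w) \<longlonglongrightarrow> u w * kernel_fun z w"
      using AE_disk
    proof eventually_elim
      case (elim w)
      then have "eventually (\<lambda>n. \<rho> n > cmod w) sequentially"
        using order_tendstoD(1)[OF lim, of "cmod w"] by simp
      then have "eventually (\<lambda>n. ?I n w = u w * kernel_fun z w) sequentially"
        by eventually_elim simp
      then show ?case
        by (rule tendsto_eventually)
    qed
    show "AE w in area_measure. norm (?I n w) \<le> cmod (u w) * C" for n
      using AE_disk
    proof eventually_elim
      case (elim w)
      have "norm (indicator (ball 0 (\<rho> n)) w *\<^sub>R u w) \<le> cmod (u w)"
        by (auto simp: indicator_def)
      then show ?case
        unfolding norm_mult using C(2)[OF elim] by (intro mult_mono) auto
    qed
  qed
  moreover have "(\<lambda>n. of_real ((\<rho> n)\<^sup>2) * u (of_real ((\<rho> n)\<^sup>2) * z)) \<longlonglongrightarrow> of_real (1\<^sup>2) * u (of_real (1\<^sup>2) * z)"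
  proof (intro tendsto_mult tendsto_of_real tendsto_power lim)
    have "isCont u z"
      using harmonic_on_disk_continuous[OF harmonic_bergmanD(1)[OF u]] z
      by (simp add: continuous_on_eq_continuous_at)
    moreover have "(\<lambda>n. of_real ((\<rho> n)\<^sup>2) * z) \<longlonglongrightarrow> of_real (1\<^sup>2) * z"
      by (intro tendsto_mult tendsto_of_real tendsto_power lim tendsto_const)
    ultimately show "(\<lambda>n. u (of_real ((\<rho> n)\<^sup>2) * z)) \<longlonglongrightarrow> u (of_real (1\<^sup>2) * z)"
      using isCont_tendsto_compose[of _ u] by simp
  qed
  ultimately show ?thesis
    unfolding val using LIMSEQ_unique by fastforce
qed

text \<open>A definite description needs existence and uniqueness. The candidate is bounded and
  harmonic, and it is real, so the conjugation in \<open>l2_inner\<close> leaves the reproducing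
  formula intact. A competitor differs from it by a v orthogonal to every member of the space, v
  itself included.\<close>

lemma bergman_kernel_eq:
  assumes z: "z \<in> disk"
  shows "bergman_kernel z = (\<lambda>w. if w \<in> disk then kernel_fun z w else 0)"
proof -
  define K where "K = (\<lambda>w. if w \<in> disk then kernel_fun z w else 0)"
  have ne: "1 - cnj z * w \<noteq> 0" if "w \<in> disk" for w
  proof
    assume "1 - cnj z * w = 0"
    then have "cmod z * cmod w = 1"
      by (metis complex_mod_cnj eq_iff_diff_eq_0 norm_mult norm_one)
    moreover have "cmod z * cmod w \<le> 1 * cmod w" using z by (intro mult_right_mono) auto
    ultimately show False using that by simp
  qed
  have K: "K \<in> harmonic_bergman"
  proof -
    obtain C where C: "C \<ge> 0" "\<And>w. w \<in> disk \<Longrightarrow> cmod (kernel_fun z w) \<le> C"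
      using kernel_fun_bounded[OF z] by blast
    show ?thesis
    proof (rule bounded_harmonic_in_harmonic_bergman)
      show "(\<lambda>w. 1 / (1 - cnj z * w)\<^sup>2 - 1) holomorphic_on disk" "(\<lambda>w. 1 / (1 - cnj z * w)\<^sup>2) holomorphic_on disk"
        using ne by (auto intro!: holomorphic_intros)
    qed (use C in \<open>auto simp: K_def kernel_fun_def\<close>)
  qed
  have inner: "l2_inner u K = u z" if "u \<in> harmonic_bergman" for u
  proof -
    have "l2_inner u K = (LINT w|area_measure. u w * kernel_fun z w)"
      unfolding l2_inner_def K_def
      by (intro Bochner_Integration.integral_cong) (auto simp: space_area_measure cnj_kernel_fun)
    then show ?thesis using kernel_fun_reproducing[OF that z] by simp
  qed
  show ?thesis
    unfolding bergman_kernel_def K_def[symmetric]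
  proof (rule the_equality)
    show "K \<in> harmonic_bergman \<and> (\<forall>u\<in>harmonic_bergman. u z = l2_inner u K)"
      using K inner by simp
    fix R assume R: "R \<in> harmonic_bergman \<and> (\<forall>u\<in>harmonic_bergman. u z = l2_inner u R)"
    define v where "v = (\<lambda>w. R w - K w)"
    have v: "v \<in> harmonic_bergman"
      unfolding v_def using R K by (intro harmonic_bergman_diff) auto
    \<comment> \<open>Both terms on the right equal v(z), so v has norm zero.\<close>
    have "(LINT w|area_measure. v w * cnj (v w)) = l2_inner v R - l2_inner v K"
      unfolding l2_inner_def using integrable_mult_harmonic_bergman[OF v] R K
      by (subst Bochner_Integration.integral_diff[symmetric]) (auto simp: v_def algebra_simps)
    also have "\<dots> = 0"
      using R v inner by auto
    finally have "complex_of_real (LINT w|area_measure. (cmod (v w))\<^sup>2) = 0"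
      by (subst integral_complex_of_real[symmetric]) (simp only: complex_norm_square)
    then have "(LINT w|area_measure. (cmod (v w))\<^sup>2) = 0" by simp
    then have "AE w in area_measure. v w = 0"
      using integral_nonneg_eq_0_iff_AE[OF harmonic_bergmanD(3)[OF v]] by simp
    \<comment> \<open>Each value of v is an integral of v against the kernel, which lifts vanishing
      almost everywhere to vanishing everywhere on the disk.\<close>
    then have "v w = 0" if "w \<in> disk" for w
      using kernel_fun_reproducing[OF v that]
      by (metis (mono_tags, lifting) eventually_mono integral_eq_zero_AE mult_zero_left)
    then have "v w = 0" for w
      using harmonic_bergmanD(2)[OF v] by blast
    then show "R = K"
      by (auto simp: v_def fun_eq_iff)
  qed
qed

section \<open>Uniqueness of radial moments\<close>

text \<open>\<open>ennreal\<close> sends negative numbers to 0, so \<open>ennreal (f x)\<close> and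
  \<open>ennreal (- f x)\<close> are the positive and negative parts of f. As densities they give
  finite measures that agree on half-lines, so the two parts agree almost everywhere, which forces f
  = 0.\<close>

lemma AE_eq_0_if_integral_greaterThan_eq_0:
  fixes f :: "real \<Rightarrow> real"
  assumes f: "integrable lborel f"
    and 0: "\<And>a. (LINT x|lborel. f x * indicator {a<..} x) = 0"
  shows "AE x in lborel. f x = 0"
proof -
  have [measurable]: "f \<in> borel_measurable borel"
    using borel_measurable_integrable[OF f] by simp
  have fin: "(\<integral>\<^sup>+x. ennreal (g x) * indicator {a<..} x \<partial>lborel) < \<infinity>" if "integrable lborel g" for a and g :: "real \<Rightarrow> real"
  proof -
    have "(\<integral>\<^sup>+x. ennreal (g x) * indicator {a<..} x \<partial>lborel) \<le> (\<integral>\<^sup>+x. ennreal (norm (g x)) \<partial>lborel)"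
      by (intro nn_integral_mono) (auto simp: indicator_def intro!: ennreal_leI)
    also have "\<dots> < \<infinity>"
      using that by (simp add: integrable_iff_bounded)
    finally show ?thesis .
  qed
  have "density lborel (\<lambda>x. ennreal (f x)) = density lborel (\<lambda>x. ennreal (- f x))"
  proof (rule measure_eqI_lessThan)
    fix a :: real
    let ?P = "\<integral>\<^sup>+x. ennreal (f x) * indicator {a<..} x \<partial>lborel"
    let ?N = "\<integral>\<^sup>+x. ennreal (- f x) * indicator {a<..} x \<partial>lborel"
    have P: "?P < \<infinity>" and N: "?N < \<infinity>"
      using fin[OF f, of a] fin[OF Bochner_Integration.integrable_minus[OF f], of a] by simp_all
    then show "emeasure (density lborel (\<lambda>x. ennreal (f x))) {a<..} < \<infinity>"
      by (simp add: emeasure_density)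
    have "integrable lborel (\<lambda>x. f x * indicator {a<..} x)"
      using integrable_real_mult_indicator[OF _ f, of "{a<..}"] by simp
    then have "(LINT x|lborel. f x * indicator {a<..} x)
        = enn2real (\<integral>\<^sup>+x. ennreal (f x * indicator {a<..} x) \<partial>lborel)
        - enn2real (\<integral>\<^sup>+x. ennreal (- (f x * indicator {a<..} x)) \<partial>lborel)"
      by (rule real_lebesgue_integral_def)
    also have "(\<integral>\<^sup>+x. ennreal (f x * indicator {a<..} x) \<partial>lborel) = ?P"
      by (intro nn_integral_cong) (auto simp: indicator_def)
    also have "(\<integral>\<^sup>+x. ennreal (- (f x * indicator {a<..} x)) \<partial>lborel) = ?N"
      by (intro nn_integral_cong) (auto simp: indicator_def)
    finally have "enn2real ?P = enn2real ?N"
      using 0[of a] by simp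
    then have "?P = ?N"
      using P N by (metis ennreal_enn2real infinity_ennreal_def)
    then show "emeasure (density lborel (\<lambda>x. ennreal (f x))) {a<..} = emeasure (density lborel (\<lambda>x. ennreal (- f x))) {a<..}"
      by (simp add: emeasure_density)
  qed auto
  then have "AE x in lborel. ennreal (f x) = ennreal (- f x)"
    by (intro sigma_finite_measure.density_unique[OF sigma_finite_lborel]) auto
  then show ?thesis
  proof eventually_elim
    case (elim x)
    then show ?case
      by (cases "f x" "0::real" rule: linorder_cases) (auto simp: ennreal_neg)
  qed
qed

text \<open>The weight r vanishes at 0, so the open interval suffices; division by r and negative
  powers of r are then harmless.\<close>

lemma AE_radial_measureI:
  assumes "AE r in lebesgue. r \<in> {0<..<1} \<longrightarrow> P r"
  shows "AE r in radial_measure. P r"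
proof -
  have ms: "{0..<1::real} \<in> sets lebesgue"
    by (intro sets_completionI_sets) simp
  have "AE r in lebesgue. r \<in> {0..<1} \<longrightarrow> 0 < ennreal r \<longrightarrow> P r"
    using assms by eventually_elim auto
  then have "AE r in lebesgue_on {0..<1}. 0 < ennreal r \<longrightarrow> P r"
    using ms by (subst AE_restrict_space_iff) auto
  moreover have "(\<lambda>r. ennreal r) \<in> borel_measurable (lebesgue_on {0..<1::real})"
    by (intro measurable_restrict_space1) (rule measurable_completion, simp)
  ultimately show ?thesis
    unfolding radial_measure_def by (subst AE_density) auto
qed

lemma AE_radial_measureD:
  assumes "AE r in radial_measure. P r"
  shows "AE r in lebesgue. r \<in> {0<..<1} \<longrightarrow> P r"
proof -
  have ms: "{0..<1::real} \<in> sets lebesgue"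
    by (intro sets_completionI_sets) simp
  have "(\<lambda>r. ennreal r) \<in> borel_measurable (lebesgue_on {0..<1::real})"
    by (intro measurable_restrict_space1) (rule measurable_completion, simp)
  then have "AE r in lebesgue_on {0..<1}. 0 < ennreal r \<longrightarrow> P r"
    using assms unfolding radial_measure_def by (subst (asm) AE_density) auto
  then have "AE r in lebesgue. r \<in> {0..<1} \<longrightarrow> 0 < ennreal r \<longrightarrow> P r"
    using ms by (subst (asm) AE_restrict_space_iff) auto
  then show ?thesis
    by eventually_elim auto
qed

lemma borel_measurable_radial_measure:
  assumes "g \<in> borel_measurable borel"
  shows "g \<in> borel_measurable radial_measure"
  unfolding borel_measurable_radial_measure_iff
  by (intro measurable_restrict_space1) (rule measurable_completion, simp add: assms)

text \<open>The weight is absorbed by applying the criterion on the line to r g(r), cut off outside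
  the unit interval and replaced by a Borel version h. Since r > 0 on the open interval, g vanishes
  with it.\<close>

lemma radial_measure_AE_eq_0:
  fixes g :: "real \<Rightarrow> real"
  assumes g: "integrable radial_measure g"
    and 0: "\<And>a. (LINT r|radial_measure. g r * indicator {a<..} r) = 0"
  shows "AE r in radial_measure. g r = 0"
proof -
  have gm: "g \<in> borel_measurable radial_measure"
    using g by simp
  let ?H = "\<lambda>r. indicator {0..<1} r *\<^sub>R (r *\<^sub>R g r)"
  have H: "integrable lebesgue ?H"
    using g unfolding integrable_radial_measure_iff[OF gm] .
  obtain h where h [measurable]: "h \<in> borel_measurable lborel" and Hh: "AE r in lborel. ?H r = h r"
    using completion_ex_borel_measurable_real[OF borel_measurable_integrable[OF H]] by blast
  have h': "h \<in> borel_measurable lebesgue"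
    by (rule measurable_completion) measurable
  have "integrable lebesgue h"
    using H integrable_cong_AE[OF borel_measurable_integrable[OF H] h' AE_completion[OF Hh]] by simp
  then have hi: "integrable lborel h"
    by (simp add: integrable_completion)
  have "AE r in lborel. h r = 0"
  proof (rule AE_eq_0_if_integral_greaterThan_eq_0[OF hi])
    fix a :: real
    have ia: "indicator {a<..} \<in> borel_measurable radial_measure"
      by (intro borel_measurable_radial_measure) measurable
    have "(LINT r|lborel. h r * indicator {a<..} r) = (LINT r|lebesgue. h r * indicator {a<..} r)"
      by (subst integral_completion) auto
    also have "\<dots> = (LINT r|lebesgue. indicator {0..<1} r *\<^sub>R (r *\<^sub>R (g r * indicator {a<..} r)))"
    proof (rule integral_cong_AE)
      have ia': "indicator {a<..} \<in> borel_measurable lebesgue"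
        by (rule measurable_completion) measurable
      show "(\<lambda>r. h r * indicator {a<..} r) \<in> borel_measurable lebesgue"
        using h' ia' by measurable
      have "(\<lambda>r. ?H r * indicator {a<..} r) \<in> borel_measurable lebesgue"
        using borel_measurable_integrable[OF H] ia' by (rule borel_measurable_times)
      then show "(\<lambda>r. indicator {0..<1} r *\<^sub>R (r *\<^sub>R (g r * indicator {a<..} r))) \<in> borel_measurable lebesgue"
        by (simp add: mult.assoc)
      show "AE r in lebesgue. h r * indicator {a<..} r = indicator {0..<1} r *\<^sub>R (r *\<^sub>R (g r * indicator {a<..} r))"
        using AE_completion[OF Hh] by eventually_elim auto
    qed
    also have "\<dots> = (LINT r|radial_measure. g r * indicator {a<..} r)"
      by (rule integral_radial_measure[symmetric]) (rule borel_measurable_times[OF gm ia])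
    finally show "(LINT r|lborel. h r * indicator {a<..} r) = 0"
      using 0 by simp
  qed
  then have "AE r in lborel. ?H r = 0"
    using Hh by eventually_elim simp
  then have "AE r in lebesgue. ?H r = 0"
    by (rule AE_completion)
  then have "AE r in lebesgue. r \<in> {0<..<1} \<longrightarrow> g r = 0"
    by eventually_elim (auto simp: indicator_def)
  then show ?thesis
    by (rule AE_radial_measureI)
qed

lemma finite_measure_radial_measure: "finite_measure radial_measure"
proof
  have ms: "{0..<1::real} \<in> sets lebesgue"
    by (intro sets_completionI_sets) simp
  have "(\<lambda>r. ennreal r) \<in> borel_measurable (lebesgue_on {0..<1::real})"
    by (intro measurable_restrict_space1) (rule measurable_completion, simp)
  then have "emeasure radial_measure (space radial_measure)
      = (\<integral>\<^sup>+r. ennreal r * indicator {0..<1} r \<partial>lebesgue_on {0..<1})"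
    unfolding radial_measure_def
    by (subst emeasure_density) (auto simp: sets_restrict_space_iff ms)
  also have "\<dots> \<le> (\<integral>\<^sup>+r. 1 \<partial>lebesgue_on {0..<1::real})"
    by (intro nn_integral_mono) (auto simp: indicator_def)
  also have "\<dots> = emeasure lebesgue {0..<1::real}"
    using ms by (simp add: emeasure_restrict_space)
  also have "\<dots> < \<infinity>" by simp
  finally show "emeasure radial_measure (space radial_measure) \<noteq> \<infinity>" by simp
qed

lemma space_radial_measure: "space radial_measure = {0..<1}"
  by (simp add: radial_measure_def)

lemma integrable_radial_measure_mult_bounded:
  fixes g h :: "real \<Rightarrow> 'a::{real_normed_div_algebra,euclidean_space}"
  assumes g: "integrable radial_measure g" and h: "h \<in> borel_measurable borel"
    and b: "\<And>r. r \<in> {0..<1} \<Longrightarrow> norm (h r) \<le> C"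
  shows "integrable radial_measure (\<lambda>r. g r * h r)"
proof (rule Bochner_Integration.integrable_bound)
  show "integrable radial_measure (\<lambda>r. norm (g r) * C)"
    using g by simp
  show "(\<lambda>r. g r * h r) \<in> borel_measurable radial_measure"
    using g borel_measurable_radial_measure[OF h] by measurable
  show "AE r in radial_measure. norm (g r * h r) \<le> norm (norm (g r) * C)"
  proof (rule AE_I2)
    fix r assume "r \<in> space radial_measure"
    then have "norm (h r) \<le> \<bar>C\<bar>" using b[of r] by (simp add: space_radial_measure)
    then show "norm (g r * h r) \<le> norm (norm (g r) * C)"
      by (simp add: norm_mult abs_mult mult_left_mono)
  qed
qed

text \<open>Weierstrass approximation of \<open>t \<mapsto> h (root d t)\<close> on the unit interval approximates \<open>h\<close> by polynomials in \<open>r ^ d\<close>.\<close>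

lemma moments_zero_imp_integral_continuous_zero:
  fixes g :: "real \<Rightarrow> real"
  assumes g: "integrable radial_measure g" and d: "d > 0"
    and mom: "\<And>l. (LINT r|radial_measure. g r * r ^ (d * l)) = 0"
    and h: "continuous_on UNIV h"
  shows "(LINT r|radial_measure. g r * h r) = 0"
proof -
  have hb: "h \<in> borel_measurable borel"
    using h by (rule borel_measurable_continuous_onI)
  have cont: "continuous_on {0..1} (\<lambda>t. h (root d t))"
    by (intro continuous_on_compose2[OF h] continuous_intros) auto
  have approx: "\<exists>p. real_polynomial_function p \<and> (\<forall>t\<in>{0..1}. \<bar>h (root d t) - p t\<bar> < e)" if "e > 0" for e
    by (rule Stone_Weierstrass_real_polynomial_function[OF compact_Icc cont that]) blast
  have le: "\<bar>LINT r|radial_measure. g r * h r\<bar> \<le> e * (LINT r|radial_measure. \<bar>g r\<bar>)" if e: "e > 0" for e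
  proof -
    obtain p where p: "real_polynomial_function p" "\<And>t. t \<in> {0..1} \<Longrightarrow> \<bar>h (root d t) - p t\<bar> < e"
      using approx[OF e] by blast
    obtain a n where pa: "p = (\<lambda>x. \<Sum>i\<le>n. a i * x ^ i)"
      using p(1) unfolding real_polynomial_function_iff_sum by blast
    have close: "\<bar>h r - p (r ^ d)\<bar> \<le> e" if "r \<in> {0..<1}" for r
      using p(2)[of "r ^ d"] that d by (auto simp: power_le_one real_root_power_cancel intro!: less_imp_le)
    have pint: "integrable radial_measure (\<lambda>r. g r * r ^ (d * i))" for i
      by (rule integrable_radial_measure_mult_bounded[OF g, of _ 1]) (auto simp: power_le_one)
    have "(\<lambda>r. g r * p (r ^ d)) = (\<lambda>r. \<Sum>i\<le>n. a i * (g r * r ^ (d * i)))"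
      unfolding pa sum_distrib_left power_mult by (simp only: mult.left_commute)
    then have pz: "(LINT r|radial_measure. g r * p (r ^ d)) = 0"
      and pi: "integrable radial_measure (\<lambda>r. g r * p (r ^ d))"
      using mom pint by simp_all
    have "compact (h ` {0..1})"
      using h by (intro compact_continuous_image) (auto intro: continuous_on_subset)
    then have "\<exists>C. \<forall>r\<in>{0..1}. norm (h r) \<le> C"
      by (auto dest!: compact_imp_bounded simp: bounded_iff)
    then obtain C where C: "\<forall>r\<in>{0..1}. norm (h r) \<le> C" ..
    have hi: "integrable radial_measure (\<lambda>r. g r * h r)"
      by (rule integrable_radial_measure_mult_bounded[OF g hb, of C]) (use C in auto)
    have "(LINT r|radial_measure. g r * h r) = (LINT r|radial_measure. g r * h r - g r * p (r ^ d))"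
      using hi pi pz by simp
    then have "\<bar>LINT r|radial_measure. g r * h r\<bar> \<le> (LINT r|radial_measure. \<bar>g r * h r - g r * p (r ^ d)\<bar>)"
      by (simp only: integral_abs_bound)
    also have "\<dots> \<le> (LINT r|radial_measure. e * \<bar>g r\<bar>)"
    proof (rule integral_mono)
      show "integrable radial_measure (\<lambda>r. \<bar>g r * h r - g r * p (r ^ d)\<bar>)"
        using hi pi by (intro integrable_abs Bochner_Integration.integrable_diff)
      show "integrable radial_measure (\<lambda>r. e * \<bar>g r\<bar>)"
        using g by (intro integrable_mult_right integrable_abs)
      fix r assume "r \<in> space radial_measure"
      then have "\<bar>h r - p (r ^ d)\<bar> \<le> e"
        using close by (simp add: space_radial_measure)
      then have "\<bar>g r\<bar> * \<bar>h r - p (r ^ d)\<bar> \<le> \<bar>g r\<bar> * e"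
        by (rule mult_left_mono) simp
      then show "\<bar>g r * h r - g r * p (r ^ d)\<bar> \<le> e * \<bar>g r\<bar>"
        by (simp add: abs_mult[symmetric] right_diff_distrib mult.commute)
    qed
    finally show ?thesis by simp
  qed
  show ?thesis
  proof (rule ccontr)
    assume ne: "(LINT r|radial_measure. g r * h r) \<noteq> 0"
    define G where "G = (LINT r|radial_measure. \<bar>g r\<bar>)"
    have G: "G \<ge> 0" by (simp add: G_def)
    define x where "x = \<bar>LINT r|radial_measure. g r * h r\<bar>"
    have x: "x > 0" using ne by (simp add: x_def)
    \<comment> \<open>This tolerance makes the bound smaller than x; the added 1 covers G =
      0.\<close>
    have "x / (2 * (G + 1)) > 0" using x G by simp
    from le[OF this] have "x \<le> x / (2 * (G + 1)) * G"
      unfolding x_def[symmetric] G_def[symmetric] .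
    moreover have "x / (2 * (G + 1)) * G < x"
      using x G by (simp add: field_simps add_nonneg_pos)
    ultimately show False by simp
  qed
qed

text \<open>The continuous ramps \<open>?h n\<close> have values in [0,1] and tend pointwise to the
  indicator of {a<..}. Dominated convergence carries the vanishing from continuous functions to
  half-lines.\<close>

lemma moments_zero_imp_AE_eq_0_real:
  fixes g :: "real \<Rightarrow> real"
  assumes g: "integrable radial_measure g" and d: "d > 0"
    and mom: "\<And>l. (LINT r|radial_measure. g r * r ^ (d * l)) = 0"
  shows "AE r in radial_measure. g r = 0"
proof (rule radial_measure_AE_eq_0[OF g])
  fix a :: real
  let ?h = "\<lambda>n r. max 0 (min 1 (real n * (r - a)))"
  have hm: "?h n \<in> borel_measurable radial_measure" for n
    by (intro borel_measurable_radial_measure) measurable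
  have im: "indicator {a<..} \<in> borel_measurable radial_measure"
    by (intro borel_measurable_radial_measure) measurable
  have gm: "g \<in> borel_measurable radial_measure" using g by simp
  have "(\<lambda>n. LINT r|radial_measure. g r * ?h n r) \<longlonglongrightarrow> (LINT r|radial_measure. g r * indicator {a<..} r)"
  proof (rule integral_dominated_convergence)
    show "(\<lambda>r. g r * indicator {a<..} r) \<in> borel_measurable radial_measure"
      using gm im by measurable
    show "(\<lambda>r. g r * ?h n r) \<in> borel_measurable radial_measure" for n
      using gm hm[of n] by (rule borel_measurable_times)
    show "integrable radial_measure (\<lambda>r. \<bar>g r\<bar>)"
      using g by (rule integrable_abs)
    show "AE r in radial_measure. (\<lambda>n. g r * ?h n r) \<longlonglongrightarrow> g r * indicator {a<..} r"
    proof (intro AE_I2 tendsto_mult tendsto_const)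
      fix r :: real
      show "(\<lambda>n. ?h n r) \<longlonglongrightarrow> indicator {a<..} r"
      proof (cases "a < r")
        case True
        then obtain N :: nat where N: "1 < real N * (r - a)"
          using ex_less_of_nat_mult[of "r - a" 1] by auto
        have "?h n r = 1" if "n \<ge> N" for n
        proof -
          have "real N * (r - a) \<le> real n * (r - a)"
            using True that by (intro mult_right_mono) auto
          then show ?thesis using N by simp
        qed
        then show ?thesis
          using True by (intro tendsto_eventually) (auto simp: eventually_sequentially)
      next
        case False
        then have le: "real n * (r - a) \<le> 0" for n
          by (intro mult_nonneg_nonpos) auto
        have "?h n r = 0" for n
          using le[of n] by simp
        then show ?thesis using False by simp
      qed
    qed
    show "AE r in radial_measure. norm (g r * ?h n r) \<le> \<bar>g r\<bar>" for n
    proof (rule AE_I2)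
      fix r
      have "\<bar>g r\<bar> * \<bar>?h n r\<bar> \<le> \<bar>g r\<bar> * 1"
        by (intro mult_left_mono) auto
      then show "norm (g r * ?h n r) \<le> \<bar>g r\<bar>" by (simp add: abs_mult)
    qed
  qed
  moreover have "(LINT r|radial_measure. g r * ?h n r) = 0" for n
    by (rule moments_zero_imp_integral_continuous_zero[OF g d mom]) (intro continuous_intros)
  ultimately show "(LINT r|radial_measure. g r * indicator {a<..} r) = 0"
    by (simp add: LIMSEQ_const_iff)
qed

lemma moments_zero_imp_AE_eq_0:
  fixes g :: "real \<Rightarrow> complex"
  assumes g: "integrable radial_measure g" and d: "d > 0"
    and mom: "\<And>l. (LINT r|radial_measure. g r * of_real (r ^ (d * l))) = 0"
  shows "AE r in radial_measure. g r = 0"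
proof -
  have gi: "integrable radial_measure (\<lambda>r. g r * of_real (r ^ (d * l)))" for l
    by (rule integrable_radial_measure_mult_bounded[OF g, of _ 1]) (auto simp: norm_power power_le_one)
  have "(LINT r|radial_measure. Re (g r) * r ^ (d * l)) = 0" for l
    using integral_Re[OF gi[of l]] mom[of l] by simp
  then have "AE r in radial_measure. Re (g r) = 0"
    using g d by (intro moments_zero_imp_AE_eq_0_real[of _ d]) auto
  moreover have "(LINT r|radial_measure. Im (g r) * r ^ (d * l)) = 0" for l
    using integral_Im[OF gi[of l]] mom[of l] by simp
  then have "AE r in radial_measure. Im (g r) = 0"
    using g d by (intro moments_zero_imp_AE_eq_0_real[of _ d]) auto
  ultimately show ?thesis
    by eventually_elim (simp add: complex_eq_iff)
qed

section \<open>Toeplitz operators on powers\<close>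

definition disk_power :: "nat \<Rightarrow> complex \<Rightarrow> complex" where
  "disk_power k z = (if z \<in> disk then z ^ k else 0)"

lemma harmonic_polynomial_disk_power: "harmonic_polynomial (disk_power k)"
  unfolding harmonic_polynomial_def
proof (intro exI)
  show "disk_power k = (\<lambda>z. if z \<in> disk then \<Sum>j\<le>k. (if j = k then 1 else 0) * z ^ j + 0 * cnj z ^ j else 0)"
    by (simp add: disk_power_def fun_eq_iff if_distrib[of "\<lambda>x. x * _"] cong: if_cong)
qed

lemma disk_power_in_harmonic_bergman: "disk_power k \<in> harmonic_bergman"
proof (rule bounded_harmonic_in_harmonic_bergman)
  show "(\<lambda>z. z ^ k) holomorphic_on disk" "(\<lambda>z. 0) holomorphic_on disk"
    by (intro holomorphic_intros)+
  show "cmod (disk_power k z) \<le> 1" if "z \<in> disk" for z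
    using that by (simp add: disk_power_def norm_power power_le_one)
qed (auto simp: disk_power_def)

text \<open>\<open>Arg\<close> jumps at the branch cut, whereas \<open>sgn\<close> is
  multiplicative; in this form rotations act visibly, for negative p as well.\<close>

lemma quasihomogeneous_nonzero:
  assumes "z \<noteq> 0"
  shows "quasihomogeneous p \<phi> z = sgn z powi p * \<phi> (cmod z)"
  using assms by (simp add: quasihomogeneous_def cis_Arg[symmetric] cis_power_int)

lemma quasihomogeneous_rotation:
  assumes "z \<noteq> 0"
  shows "quasihomogeneous p \<phi> (cis t * z) = cis (of_int p * t) * quasihomogeneous p \<phi> z"
  using assms by (simp add: quasihomogeneous_nonzero sgn_mult power_int_mult_distrib cis_power_int norm_mult)

text \<open>The symbol times w^k has frequency k + p, so only one term of the kernel series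
  survives, and its coefficient is a radial integral. Taking q as a natural number restricts the
  formula to images that are analytic powers.\<close>

lemma toeplitz_disk_power:
  assumes T: "toeplitz_operator (quasihomogeneous p \<phi>) T" and \<phi>: "\<phi> \<in> borel_measurable radial_measure"
    and q: "int q = int k + p"
  shows "T (disk_power k) = (\<lambda>z. (2 * of_nat (Suc q) * (LINT r|radial_measure. \<phi> r * of_real (r ^ (k + q)))) * disk_power q z)"
proof
  fix z
  let ?f = "quasihomogeneous p \<phi>"
  let ?F = "\<lambda>w. ?f w * w ^ k"
  have fi: "integrable area_measure ?f" and bT: "bounded_operator T"
    and Tu: "\<And>u z. harmonic_polynomial u \<Longrightarrow> z \<in> disk \<Longrightarrow> T u z = (LINT w|area_measure. ?f w * u w * bergman_kernel z w)"
    using T unfolding toeplitz_operator_def by blast+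
  have fm: "?f \<in> borel_measurable area_measure" using fi by simp
  have pm: "(\<lambda>w. w ^ k) \<in> borel_measurable area_measure" for k
    by (intro borel_measurable_area_measure borel_measurable_continuous_onI continuous_intros)
  have cpm: "(\<lambda>w. cnj w ^ k) \<in> borel_measurable area_measure" for k
    by (intro borel_measurable_area_measure borel_measurable_continuous_onI continuous_intros)
  have Fm: "?F \<in> borel_measurable area_measure"
    using fm pm by (rule borel_measurable_times)
  have Fi: "integrable area_measure ?F"
  proof (rule Bochner_Integration.integrable_bound[OF fi Fm])
    show "AE w in area_measure. norm (?f w * w ^ k) \<le> norm (?f w)"
      using AE_disk by eventually_elim (simp add: norm_mult norm_power power_le_one mult_right_le_one_le)
  qed
  show "T (disk_power k) z = (2 * of_nat (Suc q) * (LINT r|radial_measure. \<phi> r * of_real (r ^ (k + q)))) * disk_power q z"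
  proof (cases "z \<in> disk")
    case False
    have "T (disk_power k) \<in> harmonic_bergman"
      using bT disk_power_in_harmonic_bergman by (auto simp: bounded_operator_def)
    then show ?thesis
      using False harmonic_bergmanD(2) by (simp add: disk_power_def)
  next
    case True
    have "T (disk_power k) z = (LINT w|area_measure. ?f w * disk_power k w * bergman_kernel z w)"
      by (rule Tu[OF harmonic_polynomial_disk_power True])
    also have "\<dots> = (LINT w|area_measure. ?F w * kernel_fun z w)"
      by (intro Bochner_Integration.integral_cong refl)
         (simp add: space_area_measure bergman_kernel_eq[OF True] disk_power_def)
    also have "\<dots> = of_nat (Suc q) * z ^ q * (LINT w|area_measure. ?F w * cnj w ^ q)"
    proof (rule integral_homogeneous_mult_kernel_fun[OF Fi True])
      fix t and w :: complex assume w: "w \<noteq> 0"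
      have "of_int p * t + real k * t = (of_int p + real k) * t"
        by (simp add: algebra_simps)
      also have "of_int p + real k = real q"
        using q by (metis add.commute of_int_add of_int_of_nat_eq)
      finally have "cis (of_int p * t) * cis (real k * t) = cis (real q * t)"
        by (simp add: cis_mult)
      moreover have "?f (cis t * w) * (cis t * w) ^ k = (cis (of_int p * t) * cis (real k * t)) * (?f w * w ^ k)"
        unfolding quasihomogeneous_rotation[OF w] power_mult_distrib Complex.DeMoivre by (simp only: mult_ac)
      ultimately show "?f (cis t * w) * (cis t * w) ^ k = cis (real q * t) * (?f w * w ^ k)"
        by simp
    qed
    also have "(LINT w|area_measure. ?F w * cnj w ^ q) = 2 * (LINT r|radial_measure. \<phi> r * of_real (r ^ (k + q)))"
    proof (rule integral_area_measure_radial)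
      show "(\<lambda>w. ?F w * cnj w ^ q) \<in> borel_measurable area_measure"
        using Fm cpm by (rule borel_measurable_times)
      show "(\<lambda>r. \<phi> r * of_real (r ^ (k + q))) \<in> borel_measurable radial_measure"
        by (intro borel_measurable_times \<phi> borel_measurable_radial_measure borel_measurable_continuous_onI continuous_intros)
      show "AE w in area_measure. ?F w * cnj w ^ q = \<phi> (cmod w) * of_real (cmod w ^ (k + q))"
        using AE_area_measure_nonzero
      proof eventually_elim
        case (elim w)
        \<comment> \<open>The unimodular factors cancel because k + p = q, leaving a function of the
          modulus alone.\<close>
        have w: "w = of_real (cmod w) * sgn w"
          using elim by (simp add: sgn_eq)
        have s: "sgn w * cnj (sgn w) = 1" "sgn w \<noteq> 0"
          using elim by (simp_all add: sgn_eq complex_norm_square[symmetric] field_simps power2_eq_square)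
        have "sgn w powi p * sgn w ^ k = sgn w ^ q"
          using s(2) q by (simp add: power_int_add[symmetric] add.commute flip: power_int_of_nat)
        then have "sgn w powi p * sgn w ^ k * cnj (sgn w) ^ q = 1"
          by (simp add: power_mult_distrib[symmetric] s(1))
        moreover have "w ^ k = of_real (cmod w) ^ k * sgn w ^ k" "cnj w ^ q = of_real (cmod w) ^ q * cnj (sgn w) ^ q"
          by (subst w, simp add: power_mult_distrib)+
        ultimately show ?case
          by (simp add: quasihomogeneous_nonzero[OF elim] power_add mult_ac)
      qed
    qed
    finally show ?thesis
      by (simp only: disk_power_def[of q] True if_True mult_ac)
  qed
qed

lemma integral_radial_measure_power:
  "(LINT r|radial_measure. complex_of_real (r ^ j)) = 1 / of_nat (j + 2)"
proof -
  have "(LINT r|radial_measure. complex_of_real (r ^ j)) = (LINT r|radial_measure. indicator {0..<1} r *\<^sub>R complex_of_real (r ^ j))"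
    by (intro Bochner_Integration.integral_cong) (simp_all add: space_radial_measure)
  then show ?thesis
    using integral_radial_power[of 1 j] by simp
qed

text \<open>Both orders of composition send z^(q+s) to a multiple of z^(q+P); the two multiples are
  compared. Starting from the exponent q + s lets S land on z^q, so the formula for analytic powers
  covers every step.\<close>

lemma commuting_moment_recurrence:
  fixes m s P q :: nat
  assumes T: "toeplitz_operator (quasihomogeneous (int P) \<phi>) T" and \<phi>: "\<phi> \<in> borel_measurable radial_measure"
    and S: "toeplitz_operator (quasihomogeneous (- int s) (\<lambda>r. of_real (r ^ ((2 * m + 1) * s)))) S"
    and comm: "operators_commute T S"
  defines "M \<equiv> \<lambda>j. LINT r|radial_measure. \<phi> r * of_real (r ^ j)"
  shows "M (2 * q + P) * (of_nat (q + 1) * of_nat ((m + 1) * s + q + P + 1))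
    = M (2 * (q + s) + P) * (of_nat ((m + 1) * s + q + 1) * of_nat (q + s + P + 1))"
proof -
  define cT where "cT = (\<lambda>k. 2 * of_nat (Suc (k + P)) * M (k + (k + P)))"
  define cS :: "nat \<Rightarrow> complex" where "cS = (\<lambda>q. of_nat (q + 1) / of_nat ((m + 1) * s + q + 1))"
  have Tk: "T (disk_power k) = (\<lambda>z. cT k * disk_power (k + P) z)" for k
    unfolding cT_def M_def by (rule toeplitz_disk_power[OF T \<phi>]) simp
  have Sk: "S (disk_power (q + s)) = (\<lambda>z. cS q * disk_power q z)" for q
  proof -
    have "S (disk_power (q + s)) = (\<lambda>z. (2 * of_nat (Suc q) * (LINT r|radial_measure. of_real (r ^ ((2 * m + 1) * s)) * of_real (r ^ (q + s + q)))) * disk_power q z)"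
      by (rule toeplitz_disk_power[OF S])
         (auto intro!: borel_measurable_radial_measure borel_measurable_continuous_onI continuous_intros)
    also have "(LINT r|radial_measure. complex_of_real (r ^ ((2 * m + 1) * s)) * of_real (r ^ (q + s + q)))
        = (LINT r|radial_measure. complex_of_real (r ^ ((2 * m + 1) * s + (q + s + q))))"
      by (simp only: power_add of_real_mult)
    also have "\<dots> = 1 / of_nat ((2 * m + 1) * s + (q + s + q) + 2)"
      by (rule integral_radial_measure_power)
    \<comment> \<open>Here the form of n enters: the exponent is even, and halving it leaves the
      shift (m+1)s.\<close>
    also have "(2 * m + 1) * s + (q + s + q) + 2 = 2 * ((m + 1) * s + q + 1)"
      by (simp add: algebra_simps)
    also have "2 * of_nat (Suc q) * (1 / of_nat (2 * ((m + 1) * s + q + 1))) = cS q"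
      unfolding cS_def of_nat_mult by (simp del: of_nat_add of_nat_Suc)
    finally show ?thesis .
  qed
  have lin: "A (\<lambda>z. c * disk_power k z) = (\<lambda>z. c * A (disk_power k) z)"
    if "toeplitz_operator f A" for A f c k
    using that disk_power_in_harmonic_bergman by (simp add: toeplitz_operator_def bounded_operator_def)
  have "T (S (disk_power (q + s))) = (\<lambda>z. cS q * (cT q * disk_power (q + P) z))"
    unfolding Sk lin[OF T] Tk ..
  moreover have "S (T (disk_power (q + s))) = (\<lambda>z. cT (q + s) * (cS (q + P) * disk_power (q + P) z))"
    unfolding Tk lin[OF S] using Sk[of "q + P"] by (simp add: add_ac)
  moreover have "T (S (disk_power (q + s))) = S (T (disk_power (q + s)))"
    using comm disk_power_in_harmonic_bergman by (simp add: operators_commute_def)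
  \<comment> \<open>Evaluation at 1/2, a point of the disk where no power vanishes, extracts the
    coefficients.\<close>
  ultimately have "cS q * (cT q * disk_power (q + P) (1/2)) = cT (q + s) * (cS (q + P) * disk_power (q + P) (1/2))"
    by metis
  then have e: "cS q * cT q = cT (q + s) * cS (q + P)"
    by (simp add: disk_power_def)
  have cT_q: "cT q = 2 * of_nat (q + P + 1) * M (2 * q + P)" for q
  proof -
    have "q + (q + P) = 2 * q + P" "Suc (q + P) = q + P + 1" by simp_all
    then show ?thesis unfolding cT_def by (simp only:)
  qed
  have cS_qP: "cS (q + P) = of_nat (q + P + 1) / of_nat ((m + 1) * s + q + P + 1)"
    unfolding cS_def by (simp only: add.assoc)
  \<comment> \<open>The factor c stands for q + P + 1, which occurs on both sides and
    cancels.\<close>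
  have alg: "M1 * (a * d) = M2 * (b * e)"
    if "a / b * (2 * c * M1) = 2 * e * M2 * (c / d)" "b \<noteq> 0" "c \<noteq> 0" "d \<noteq> 0" for a b c d e M1 M2 :: complex
    using that by (simp add: field_simps)
  have "of_nat (q + 1) / of_nat ((m + 1) * s + q + 1) * (2 * of_nat (q + P + 1) * M (2 * q + P))
      = 2 * of_nat (q + s + P + 1) * M (2 * (q + s) + P) * (of_nat (q + P + 1) / of_nat ((m + 1) * s + q + P + 1))"
    using e unfolding cS_qP cT_q unfolding cS_def .
  then show ?thesis
    by (rule alg) (simp_all del: of_nat_add of_nat_mult of_nat_Suc)
qed

section \<open>Solution of the moment recurrence and its partial fractions\<close>

text \<open>The numerator has one factor fewer than the denominator, so there is no polynomial part.
  In the induction, multiplying by (x + b)/(x + a') for a new pole a' rescales each old residue and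
  creates one new residue. The formula for \<open>A 0\<close> is recorded because its nonvanishing
  is needed later.\<close>

lemma partial_fractions:
  fixes a b :: "nat \<Rightarrow> 'a :: field"
  assumes "inj_on a {..m}"
  shows "\<exists>A. (\<forall>x. (\<forall>j\<le>m. x + a j \<noteq> 0) \<longrightarrow>
      (\<Prod>j<m. x + b j) / (\<Prod>j\<le>m. x + a j) = (\<Sum>j\<le>m. A j / (x + a j)))
    \<and> A 0 = (\<Prod>j<m. (b j - a 0) / (a (Suc j) - a 0))"
  using assms
proof (induction m)
  case 0
  show ?case by (intro exI[of _ "\<lambda>_. 1"]) simp
next
  case (Suc m)
  have "inj_on a {..m}" using Suc.prems by (rule inj_on_subset) auto
  then obtain A where A: "\<And>x. (\<forall>j\<le>m. x + a j \<noteq> 0) \<Longrightarrow>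
      (\<Prod>j<m. x + b j) / (\<Prod>j\<le>m. x + a j) = (\<Sum>j\<le>m. A j / (x + a j))"
    and A0: "A 0 = (\<Prod>j<m. (b j - a 0) / (a (Suc j) - a 0))"
    using Suc.IH by blast
  let ?a = "a (Suc m)" and ?b = "b m"
  \<comment> \<open>An old residue is multiplied by the value of the new factor at its pole; the new
    residue is the value of the old expansion at the new pole times (b - a').\<close>
  define A' where "A' = (\<lambda>j. if j = Suc m then \<Sum>i\<le>m. A i * (?b - ?a) / (a i - ?a) else A j * (?b - a j) / (?a - a j))"
  have ne: "a j \<noteq> ?a" if "j \<le> m" for j
    using inj_onD[OF Suc.prems, of j "Suc m"] that by auto
  have "(\<Prod>j<Suc m. x + b j) / (\<Prod>j\<le>Suc m. x + a j) = (\<Sum>j\<le>Suc m. A' j / (x + a j))"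
    if x: "\<forall>j\<le>Suc m. x + a j \<noteq> 0" for x
  proof -
    have x': "\<forall>j\<le>m. x + a j \<noteq> 0" using x by auto
    have "(\<Prod>j<Suc m. x + b j) / (\<Prod>j\<le>Suc m. x + a j) = (\<Prod>j<m. x + b j) / (\<Prod>j\<le>m. x + a j) * ((x + ?b) / (x + ?a))"
      by (simp add: mult_ac)
    also have "\<dots> = (\<Sum>j\<le>m. A j / (x + a j) * ((x + ?b) / (x + ?a)))"
      unfolding A[OF x'] sum_distrib_right ..
    also have "\<dots> = (\<Sum>j\<le>m. A j * (?b - a j) / (?a - a j) / (x + a j) + A j * (?b - ?a) / (a j - ?a) / (x + ?a))"
    proof (rule sum.cong)
      fix j assume "j \<in> {..m}"
      then have n: "?a - a j \<noteq> 0" "x + a j \<noteq> 0" "x + ?a \<noteq> 0" "a j - ?a \<noteq> 0"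
        using ne[of j] x by auto
      have gen: "c * r / p / u + c * t / (- p) / v = c * (r * v - t * u) / (p * u * v)"
        if "p \<noteq> 0" "u \<noteq> 0" "v \<noteq> 0" for c r t p u v :: 'a
        using that by (simp add: field_simps)
      have d: "a j - ?a = - (?a - a j)" by simp
      have k: "(?b - a j) * (x + ?a) - (?b - ?a) * (x + a j) = (x + ?b) * (?a - a j)"
        by (simp add: algebra_simps)
      show "A j / (x + a j) * ((x + ?b) / (x + ?a)) = A j * (?b - a j) / (?a - a j) / (x + a j) + A j * (?b - ?a) / (a j - ?a) / (x + ?a)"
        unfolding d gen[OF n(1-3)] k using n(1) by simp
    qed simp
    also have "\<dots> = (\<Sum>j\<le>m. A' j / (x + a j)) + A' (Suc m) / (x + ?a)"
      by (simp add: A'_def sum.distrib sum_divide_distrib)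
    finally show ?thesis by simp
  qed
  moreover have "A' 0 = (\<Prod>j<Suc m. (b j - a 0) / (a (Suc j) - a 0))"
    by (simp add: A'_def A0)
  ultimately show ?case by blast
qed

text \<open>Against r dr the function becomes 1/r, whose integral diverges logarithmically at
  0.\<close>

lemma not_integrable_radial_inverse_square:
  "\<not> integrable radial_measure (\<lambda>r. 1 / r\<^sup>2)"
proof
  assume i: "integrable radial_measure (\<lambda>r. 1 / r\<^sup>2)"
  let ?g = "\<lambda>r::real. indicator {0..<1} r *\<^sub>R (r *\<^sub>R (1 / r\<^sup>2))"
  have "integrable lebesgue ?g"
    using i integrable_radial_measure_iff[OF borel_measurable_integrable[OF i]] by simp
  then have i: "integrable lborel ?g"
    by (subst (asm) integrable_completion) auto
  define I where "I = (LINT r|lborel. ?g r)"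
  have I: "I \<ge> 0"
    unfolding I_def by (intro Bochner_Integration.integral_nonneg) (auto simp: indicator_def)
  \<comment> \<open>Chosen so that the integral of 1/r from \<epsilon> to 1 is I + 1, more than the
    supposed total I.\<close>
  define \<epsilon> where "\<epsilon> = exp (- (I + 1))"
  have \<epsilon>: "0 < \<epsilon>" "\<epsilon> < 1" using I by (auto simp: \<epsilon>_def)
  have "integrable lborel (\<lambda>r. 1 / r * indicator {\<epsilon>..1} r) \<and> (LINT r|lborel. 1 / r * indicator {\<epsilon>..1} r) = ln 1 - ln \<epsilon>"
    using \<epsilon> by (intro conjI integrable_FTC_Icc_nonneg[of _ _ _ ln] integral_FTC_Icc_nonneg)
      (auto intro!: derivative_eq_intros)
  then have J: "integrable lborel (\<lambda>r. 1 / r * indicator {\<epsilon>..1} r)" "(LINT r|lborel. 1 / r * indicator {\<epsilon>..1} r) = I + 1"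
    by (auto simp: \<epsilon>_def)
  have "AE r in lborel. 1 / r * indicator {\<epsilon>..1} r \<le> ?g r"
    using AE_lborel_singleton[of "1::real"]
    by eventually_elim (use \<epsilon> in \<open>auto simp: indicator_def power2_eq_square divide_simps\<close>)
  then have "I + 1 \<le> I"
    unfolding J(2)[symmetric] unfolding I_def by (intro integral_mono_AE J(1) i)
  then show False by simp
qed

text \<open>The rational function \<open>F\<close> that solves the recurrence of \<open>commuting_moment_recurrence\<close> at the points \<open>x = s * l + 1\<close>.\<close>

definition moment_ratio :: "nat \<Rightarrow> nat \<Rightarrow> nat \<Rightarrow> real \<Rightarrow> real" where
  "moment_ratio m s P x = (\<Prod>j<m. x + (real (Suc j * s) + real P)) / (\<Prod>j\<le>m. x + real (j * s))"

text \<open>Replacing x by x + s moves every factor to the next index, so each product changes only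
  by its two end factors.\<close>

lemma moment_ratio_shift:
  fixes x :: real
  assumes x: "x > 0"
  shows "moment_ratio m s P (x + real s) * ((x + real ((m + 1) * s)) * (x + real s + real P))
    = moment_ratio m s P x * (x * (x + real ((m + 1) * s) + real P))"
proof -
  let ?g = "\<lambda>j. x + (real (Suc j * s) + real P)" and ?h = "\<lambda>j. x + real (j * s)"
  have "(\<Prod>j<m. x + s + (real (Suc j * s) + real P)) = (\<Prod>j<m. ?g (Suc j))"
    by (intro prod.cong) (auto simp: algebra_simps)
  then have N: "(\<Prod>j<m. x + s + (real (Suc j * s) + real P)) * ?g 0 = (\<Prod>j<m. ?g j) * ?g m"
    using prod.lessThan_Suc_shift[of ?g m] prod.lessThan_Suc[of ?g m] by (simp only: mult.commute)
  have "(\<Prod>j\<le>m. x + s + real (j * s)) = (\<Prod>j<Suc m. ?h (Suc j))"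
    unfolding lessThan_Suc_atMost by (intro prod.cong) (auto simp: algebra_simps)
  then have D: "(\<Prod>j\<le>m. x + s + real (j * s)) * ?h 0 = (\<Prod>j\<le>m. ?h j) * ?h (Suc m)"
    using prod.lessThan_Suc_shift[of ?h "Suc m"] prod.lessThan_Suc[of ?h "Suc m"]
    unfolding lessThan_Suc_atMost by (simp only: mult.commute)
  have pos: "(\<Prod>j\<le>m. ?h j) \<noteq> 0" "(\<Prod>j\<le>m. x + s + real (j * s)) \<noteq> 0"
    using x by (auto intro!: prod_pos less_imp_neq[THEN not_sym] add_pos_nonneg)
  have alg: "N1 / D1 * (d * n) = N0 / D0 * (e * k)"
    if "N1 * n = N0 * k" "D1 * e = D0 * d" "D0 \<noteq> 0" "D1 \<noteq> 0" for N0 N1 D0 D1 d e n k :: real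
  proof -
    have "N1 / D1 * (d * n) = (N1 * n) * (D0 * d) / (D0 * D1)"
      using that(3,4) by simp
    also have "\<dots> = (N0 * k) * (D1 * e) / (D0 * D1)"
      by (simp only: that(1,2))
    finally show ?thesis using that(3,4) by simp
  qed
  show ?thesis
    using alg[OF N D pos] by (simp add: moment_ratio_def algebra_simps)
qed

lemma moment_ratio_pos: "x > 0 \<Longrightarrow> moment_ratio m s P x > 0"
  unfolding moment_ratio_def by (intro divide_pos_pos prod_pos) (auto intro: add_pos_nonneg)

text \<open>\<open>A 0\<close> is the product of the numbers 1 + P/(js) for j from 1 to m, hence
  positive.\<close>

lemma moment_ratio_partial_fractions:
  assumes "s > 0"
  obtains A where "\<And>x. x > 0 \<Longrightarrow> moment_ratio m s P x = (\<Sum>j\<le>m. A j / (x + real (j * s)))" "A 0 \<noteq> 0"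
proof -
  have "inj_on (\<lambda>j. real (j * s)) {..m}"
    using assms by (auto intro!: inj_onI)
  from partial_fractions[OF this, of "\<lambda>j. real (Suc j * s) + real P"]
  obtain A where A: "\<And>x. (\<forall>j\<le>m. x + real (j * s) \<noteq> 0) \<Longrightarrow> moment_ratio m s P x = (\<Sum>j\<le>m. A j / (x + real (j * s)))"
    and A0: "A 0 = (\<Prod>j<m. (real (Suc j * s) + real P - real (0 * s)) / (real (Suc j * s) - real (0 * s)))"
    unfolding moment_ratio_def by blast
  have "A 0 > 0"
    unfolding A0 using assms by (intro prod_pos) (auto intro!: divide_pos_pos add_pos_nonneg)
  moreover have "moment_ratio m s P x = (\<Sum>j\<le>m. A j / (x + real (j * s)))" if "x > 0" for x
    using that by (intro A allI impI less_imp_neq[THEN not_sym] add_pos_nonneg) auto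
  ultimately show ?thesis using that by force
qed

text \<open>Both sequences satisfy the same recurrence along q = sl, whose leading factor
  \<open>?d\<close> never vanishes, so the value at l = 0 fixes the constant.\<close>

lemma moment_expansion:
  fixes M :: "nat \<Rightarrow> complex" and m s P :: nat
  assumes rec: "\<And>q. M (2 * q + P) * (of_nat (q + 1) * of_nat ((m + 1) * s + q + P + 1))
      = M (2 * (q + s) + P) * (of_nat ((m + 1) * s + q + 1) * of_nat (q + s + P + 1))"
  shows "M (2 * (s * l) + P) = M P / of_real (moment_ratio m s P 1) * of_real (moment_ratio m s P (real (s * l) + 1))"
proof (induction l)
  case 0
  show ?case using moment_ratio_pos[where x = 1 and m = m and s = s and P = P] by simp
next
  case (Suc l)
  let ?q = "s * l" and ?r = "moment_ratio m s P" and ?c = "M P / complex_of_real (moment_ratio m s P 1)"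
  let ?d = "of_nat ((m + 1) * s + ?q + 1) * of_nat (?q + s + P + 1) :: complex"
  have sh: "?r (real ?q + 1 + real s) * (real ((m + 1) * s + ?q + 1) * real (?q + s + P + 1))
      = ?r (real ?q + 1) * (real (?q + 1) * real ((m + 1) * s + ?q + P + 1))"
  proof -
    have "real ((m + 1) * s + ?q + 1) = real ?q + 1 + real ((m + 1) * s)" "real (?q + s + P + 1) = real ?q + 1 + real s + real P"
      "real (?q + 1) = real ?q + 1" "real ((m + 1) * s + ?q + P + 1) = real ?q + 1 + real ((m + 1) * s) + real P"
      by simp_all
    then show ?thesis
      using moment_ratio_shift[where x = "real ?q + 1" and m = m and s = s and P = P] by (simp only:)
  qed
  have "M (2 * (?q + s) + P) * ?d = M (2 * ?q + P) * (of_nat (?q + 1) * of_nat ((m + 1) * s + ?q + P + 1))"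
    by (rule rec[symmetric])
  also have "\<dots> = ?c * of_real (?r (real ?q + 1) * (real (?q + 1) * real ((m + 1) * s + ?q + P + 1)))"
    unfolding Suc.IH by (simp only: of_real_mult of_real_of_nat_eq mult.assoc)
  also have "\<dots> = ?c * of_real (?r (real ?q + 1 + real s)) * ?d"
    unfolding sh[symmetric] by (simp only: of_real_mult of_real_of_nat_eq mult.assoc)
  finally have "M (2 * (?q + s) + P) * ?d = ?c * of_real (?r (real ?q + 1 + real s)) * ?d" .
  moreover have "?d \<noteq> 0"
    unfolding mult_eq_0_iff of_nat_eq_0_iff by simp
  ultimately have "M (2 * (?q + s) + P) = ?c * of_real (?r (real ?q + 1 + real s))"
    using mult_right_cancel[of ?d] by blast
  moreover have "?q + s = s * Suc l" "real ?q + 1 + real s = real (s * Suc l) + 1"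
    by simp_all
  ultimately show ?case by (simp only:)
qed

section \<open>Recovery of the radial symbol and the bound on its degree\<close>

lemma AE_radial_eq_sum_powers:
  fixes m s P :: nat and A :: "nat \<Rightarrow> real" and c :: complex
  assumes \<phi>: "integrable radial_measure \<phi>" and s: "s > 0"
    and mom: "\<And>l. (LINT r|radial_measure. \<phi> r * of_real (r ^ (2 * (s * l) + P)))
      = c * of_real (\<Sum>j\<le>m. A j / (real (s * l) + 1 + real (j * s)))"
  shows "AE r in radial_measure. \<phi> r * of_real (r ^ P) = (\<Sum>j\<le>m. 2 * c * of_real (A j) * of_real (r ^ (2 * (j * s))))"
proof -
  interpret finite_measure radial_measure
    by (rule finite_measure_radial_measure)
  define B where "B = (\<lambda>j. 2 * c * of_real (A j))"
  define g where "g = (\<lambda>r. \<phi> r * of_real (r ^ P) - (\<Sum>j\<le>m. B j * of_real (r ^ (2 * (j * s)))))"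
  have pm: "(\<lambda>r. complex_of_real (r ^ k)) \<in> borel_measurable borel" for k
    by (intro borel_measurable_continuous_onI continuous_intros)
  have \<phi>i: "integrable radial_measure (\<lambda>r. \<phi> r * of_real (r ^ k))" for k
    by (rule integrable_radial_measure_mult_bounded[OF \<phi> pm, of _ 1]) (simp add: norm_power power_le_one)
  have pi: "integrable radial_measure (\<lambda>r. complex_of_real (r ^ k))" for k
    using integrable_radial_measure_mult_bounded[of "\<lambda>_. 1", OF _ pm, of k 1] by (simp add: norm_power power_le_one)
  have gi: "integrable radial_measure g"
    unfolding g_def
    by (intro Bochner_Integration.integrable_diff Bochner_Integration.integrable_sum integrable_mult_right \<phi>i pi)
  have "(LINT r|radial_measure. g r * of_real (r ^ (2 * s * l))) = 0" for l
  proof -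
    have "(\<lambda>r. g r * of_real (r ^ (2 * s * l))) =
       (\<lambda>r. \<phi> r * of_real (r ^ (2 * (s * l) + P)) - (\<Sum>j\<le>m. B j * of_real (r ^ (2 * (j * s) + 2 * (s * l)))))"
      unfolding g_def mult.assoc[of 2 s l] power_add of_real_mult left_diff_distrib sum_distrib_right
      by (simp only: mult_ac)
    then have "(LINT r|radial_measure. g r * of_real (r ^ (2 * s * l))) =
       (LINT r|radial_measure. \<phi> r * of_real (r ^ (2 * (s * l) + P)))
       - (\<Sum>j\<le>m. B j * (LINT r|radial_measure. complex_of_real (r ^ (2 * (j * s) + 2 * (s * l)))))"
      using \<phi>i[of "2 * (s * l) + P"] pi
      by (simp only: Bochner_Integration.integral_diff Bochner_Integration.integrable_sum integrable_mult_right
          Bochner_Integration.integral_sum integral_mult_right_zero)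
    also have "(\<Sum>j\<le>m. B j * (LINT r|radial_measure. complex_of_real (r ^ (2 * (j * s) + 2 * (s * l)))))
        = c * of_real (\<Sum>j\<le>m. A j / (real (s * l) + 1 + real (j * s)))"
      unfolding of_real_sum sum_distrib_left
    proof (rule sum.cong)
      fix j
      \<comment> \<open>The weight r and the integration together add 2 to the exponent. Half of it
        is the 1 in x = sl + 1, and the extracted factor 2 cancels against the one in
        \<open>B\<close>.\<close>
      have "2 * (j * s) + 2 * (s * l) + 2 = 2 * (s * l + 1 + j * s)" by simp
      then have "(LINT r|radial_measure. complex_of_real (r ^ (2 * (j * s) + 2 * (s * l)))) = 1 / of_nat (2 * (s * l + 1 + j * s))"
        unfolding integral_radial_measure_power by (simp only:)
      also have "\<dots> = 1 / (2 * of_real (real (s * l) + 1 + real (j * s)))"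
        by simp
      finally show "B j * (LINT r|radial_measure. complex_of_real (r ^ (2 * (j * s) + 2 * (s * l))))
          = c * of_real (A j / (real (s * l) + 1 + real (j * s)))"
        unfolding B_def of_real_divide by (simp del: of_real_add)
    qed simp
    finally show ?thesis
      using mom[of l] by simp
  qed
  then have "AE r in radial_measure. g r = 0"
    using s by (intro moments_zero_imp_AE_eq_0[OF gi, of "2 * s"]) auto
  then show ?thesis
    by eventually_elim (simp add: g_def B_def)
qed

text \<open>If P = Q + 2, divide the identity by r^2 only. Then \<phi> r^Q is still integrable and
  all terms with j >= 1 stay bounded, so B_0/r^2 would be integrable against r dr.\<close>

lemma radial_power_sum_exponent_bound:
  fixes m s P :: nat and B :: "nat \<Rightarrow> complex"
  assumes \<phi>: "integrable radial_measure \<phi>" and s: "s > 0" and B0: "B 0 \<noteq> 0"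
    and eq: "AE r in radial_measure. \<phi> r * of_real (r ^ P) = (\<Sum>j\<le>m. B j * of_real (r ^ (2 * (j * s))))"
  shows "P \<le> 1"
proof (rule ccontr)
  assume "\<not> P \<le> 1"
  then obtain Q where P: "P = Q + 2"
    by (metis add.commute le_add_diff_inverse not_less_eq_eq numeral_2_eq_2 One_nat_def)
  interpret finite_measure radial_measure
    by (rule finite_measure_radial_measure)
  have pm: "(\<lambda>r. complex_of_real (r ^ k)) \<in> borel_measurable borel" for k
    by (intro borel_measurable_continuous_onI continuous_intros)
  have \<phi>i: "integrable radial_measure (\<lambda>r. \<phi> r * of_real (r ^ k))" for k
    by (rule integrable_radial_measure_mult_bounded[OF \<phi> pm, of _ 1]) (simp add: norm_power power_le_one)
  have pi: "integrable radial_measure (\<lambda>r. complex_of_real (r ^ k))" for k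
    using integrable_radial_measure_mult_bounded[of "\<lambda>_. 1", OF _ pm, of k 1] by (simp add: norm_power power_le_one)
  \<comment> \<open>What equals 1/r^2 once the identity is divided by r^2 and solved for the term j
    = 0.\<close>
  let ?g = "\<lambda>r. (\<phi> r * of_real (r ^ Q) - (\<Sum>j\<in>{1..m}. B j * of_real (r ^ (2 * (j * s) - 2)))) / B 0"
  have gi: "integrable radial_measure ?g"
    by (intro integrable_divide Bochner_Integration.integrable_diff Bochner_Integration.integrable_sum integrable_mult_right \<phi>i pi)
  have "AE r in lebesgue. r \<in> {0<..<1} \<longrightarrow> \<phi> r * of_real (r ^ P) = (\<Sum>j\<le>m. B j * of_real (r ^ (2 * (j * s))))"
    by (rule AE_radial_measureD[OF eq])
  then have "AE r in lebesgue. r \<in> {0<..<1} \<longrightarrow> ?g r = of_real (1 / r\<^sup>2)"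
  proof eventually_elim
    case (elim r)
    show ?case
    proof
      assume r: "r \<in> {0<..<1}"
      have "(\<Sum>j\<le>m. B j * of_real (r ^ (2 * (j * s)))) = B 0 + (\<Sum>j\<in>{1..m}. B j * of_real (r ^ (2 * (j * s))))"
        unfolding atMost_atLeast0 by (subst sum.atLeast_Suc_atMost) auto
      also have "(\<Sum>j\<in>{1..m}. B j * of_real (r ^ (2 * (j * s)))) = (\<Sum>j\<in>{1..m}. B j * of_real (r ^ (2 * (j * s) - 2))) * of_real (r\<^sup>2)"
        unfolding sum_distrib_right
      proof (rule sum.cong)
        fix j assume "j \<in> {1..m}"
        \<comment> \<open>This makes the truncated subtraction in the exponent 2js - 2 a genuine
          one.\<close>
        then have "j * s \<ge> 1" using s by simp
        then have "2 * (j * s) = (2 * (j * s) - 2) + 2" by linarith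
        then have "r ^ (2 * (j * s)) = r ^ (2 * (j * s) - 2) * r\<^sup>2"
          by (metis power_add)
        then show "B j * of_real (r ^ (2 * (j * s))) = B j * of_real (r ^ (2 * (j * s) - 2)) * of_real (r\<^sup>2)"
          by (simp only: of_real_mult mult.assoc)
      qed simp
      finally have "\<phi> r * of_real (r ^ Q) * of_real (r\<^sup>2) = B 0 + (\<Sum>j\<in>{1..m}. B j * of_real (r ^ (2 * (j * s) - 2))) * of_real (r\<^sup>2)"
        using elim[rule_format, OF r] unfolding P power_add of_real_mult by (simp only: mult.assoc)
      then have "(\<phi> r * of_real (r ^ Q) - (\<Sum>j\<in>{1..m}. B j * of_real (r ^ (2 * (j * s) - 2)))) * of_real (r\<^sup>2) = B 0"
        by (simp only: left_diff_distrib) simp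
      moreover have "complex_of_real (r\<^sup>2) \<noteq> 0" using r by simp
      moreover have "X / b = 1 / R" if "X * R = b" "R \<noteq> 0" "b \<noteq> 0" for X R b :: complex
        using that by (simp add: field_simps)
      ultimately show "?g r = of_real (1 / r\<^sup>2)"
        using B0 unfolding of_real_divide of_real_1 by blast
    qed
  qed
  then have AE: "AE r in radial_measure. ?g r = of_real (1 / r\<^sup>2)"
    by (rule AE_radial_measureI)
  have "(\<lambda>r. complex_of_real (1 / r\<^sup>2)) \<in> borel_measurable radial_measure"
    by (intro borel_measurable_radial_measure) measurable
  then have "integrable radial_measure (\<lambda>r. complex_of_real (1 / r\<^sup>2))"
    using integrable_cong_AE[OF borel_measurable_integrable[OF gi] _ AE] gi by simp
  then have "integrable radial_measure (\<lambda>r. Re (complex_of_real (1 / r\<^sup>2)))"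
    by (rule integrable_Re)
  then show False
    using not_integrable_radial_inverse_square by (simp only: Re_complex_of_real)
qed

theorem theorem2:
  fixes p s m n :: int
    and \<phi> :: "real \<Rightarrow> complex"
    and S T :: "(complex \<Rightarrow> complex) \<Rightarrow> complex \<Rightarrow> complex"
  assumes "p \<ge> s" and "s > 0" and "m \<ge> 0" and "n = (2 * m + 1) * s"
    and "integrable radial_measure \<phi>"
    and "\<not> (AE r in radial_measure. \<phi> r = 0)"
    and "toeplitz_operator (quasihomogeneous p \<phi>) T"
    and "toeplitz_operator (quasihomogeneous (- s) (\<lambda>r. of_real (r powi n))) S"
    and "operators_commute T S"
  shows "p = 1 \<and> s = 1 \<and>
    (\<exists>c :: int \<Rightarrow> complex. AE r in radial_measure.
       \<phi> r = (\<Sum>j = 0..m. c j * of_real (r powi (2 * j - 1))))"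
proof -
  note \<phi> = assms(5)
  define P s' m' where "P = nat p" and "s' = nat s" and "m' = nat m"
  have p: "p = int P" and s: "s = int s'" and m: "m = int m'" and s0: "s' > 0"
    using assms(1-3) by (simp_all add: P_def s'_def m'_def)
  have n: "n = int ((2 * m' + 1) * s')"
    using assms(4) by (simp add: s m algebra_simps)
  have T: "toeplitz_operator (quasihomogeneous (int P) \<phi>) T"
    using assms(7) by (simp only: p)
  have S: "toeplitz_operator (quasihomogeneous (- int s') (\<lambda>r. of_real (r ^ ((2 * m' + 1) * s')))) S"
    using assms(8) unfolding n s power_int_of_nat .
  define M where "M = (\<lambda>j. LINT r|radial_measure. \<phi> r * of_real (r ^ j))"
  define C where "C = M P / complex_of_real (moment_ratio m' s' P 1)"
  obtain A where A: "\<And>x. x > 0 \<Longrightarrow> moment_ratio m' s' P x = (\<Sum>j\<le>m'. A j / (x + real (j * s')))" and A0: "A 0 \<noteq> 0"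
    by (rule moment_ratio_partial_fractions[OF s0]) blast
  have "M (2 * (s' * l) + P) = C * of_real (moment_ratio m' s' P (real (s' * l) + 1))" for l
    unfolding C_def
  proof (rule moment_expansion)
    fix q
    show "M (2 * q + P) * (of_nat (q + 1) * of_nat ((m' + 1) * s' + q + P + 1))
      = M (2 * (q + s') + P) * (of_nat ((m' + 1) * s' + q + 1) * of_nat (q + s' + P + 1))"
      unfolding M_def
      by (rule commuting_moment_recurrence[OF T borel_measurable_integrable[OF \<phi>] S assms(9)])
  qed
  then have mom: "(LINT r|radial_measure. \<phi> r * of_real (r ^ (2 * (s' * l) + P)))
      = C * of_real (\<Sum>j\<le>m'. A j / (real (s' * l) + 1 + real (j * s')))" for l
    unfolding M_def by (subst A[symmetric]) (auto intro: add_nonneg_pos)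
  define B where "B = (\<lambda>j. 2 * C * complex_of_real (A j))"
  have eq: "AE r in radial_measure. \<phi> r * of_real (r ^ P) = (\<Sum>j\<le>m'. B j * of_real (r ^ (2 * (j * s'))))"
    unfolding B_def by (rule AE_radial_eq_sum_powers[OF \<phi> s0 mom])
  \<comment> \<open>If C vanished, so would \<phi> r^P almost everywhere, and with it the nonzero
    symbol \<phi>.\<close>
  have "C \<noteq> 0"
  proof
    assume "C = 0"
    have "AE r in lebesgue. r \<in> {0<..<1} \<longrightarrow> \<phi> r = 0"
      using AE_radial_measureD[OF eq] by eventually_elim (use \<open>C = 0\<close> in \<open>auto simp: B_def\<close>)
    then show False
      using assms(6) AE_radial_measureI[of "\<lambda>r. \<phi> r = 0"] by blast
  qed
  then have "B 0 \<noteq> 0"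
    using A0 by (simp add: B_def)
  then have "P \<le> 1"
    by (rule radial_power_sum_exponent_bound[OF \<phi> s0 _ eq])
  \<comment> \<open>The chain 0 < s <= p <= 1 leaves only one possibility.\<close>
  then have p1: "P = 1" "s' = 1"
    using s0 assms(1) p s by auto
  have "AE r in radial_measure. \<phi> r = (\<Sum>j = 0..m. B (nat j) * of_real (r powi (2 * j - 1)))"
  proof (rule AE_radial_measureI)
    show "AE r in lebesgue. r \<in> {0<..<1} \<longrightarrow> \<phi> r = (\<Sum>j = 0..m. B (nat j) * of_real (r powi (2 * j - 1)))"
      using AE_radial_measureD[OF eq]
    proof eventually_elim
      case (elim r)
      show ?case
      proof
        assume r: "r \<in> {0<..<1}"
        \<comment> \<open>With p = s = 1 the expansion determines \<phi> times r. Here r > 0, so a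
          factor r can be split off even from the term j = 0, whose exponent becomes -1.\<close>
        have "\<phi> r * of_real r = (\<Sum>j\<le>m'. B j * of_real (r ^ (2 * j)))"
          using elim r by (simp add: p1)
        also have "\<dots> = (\<Sum>j\<le>m'. B j * of_real (r powi (2 * int j - 1))) * of_real r"
          unfolding sum_distrib_right
        proof (rule sum.cong)
          fix j
          have "r powi (2 * int j - 1) * r = r powi (2 * int j - 1 + 1)"
            using r by (subst power_int_add) auto
          also have "\<dots> = r ^ (2 * j)"
            using power_int_of_nat[of r "2 * j"] by simp
          finally show "B j * of_real (r ^ (2 * j)) = B j * of_real (r powi (2 * int j - 1)) * of_real r"
            by (metis mult.assoc of_real_mult)
        qed simp
        also have "(\<Sum>j\<le>m'. B j * complex_of_real (r powi (2 * int j - 1))) = (\<Sum>j = 0..m. B (nat j) * of_real (r powi (2 * j - 1)))"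
          by (rule sum.reindex_bij_witness[of _ nat int]) (auto simp: m)
        finally show "\<phi> r = (\<Sum>j = 0..m. B (nat j) * of_real (r powi (2 * j - 1)))"
          using r by simp
      qed
    qed
  qed
  then show ?thesis
    using p1 p s by auto
qed

end
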